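(* Let $N\ge 2$ and $K\ge 1$ be integers, let $\alpha_k,\beta_k,\delta_k>0$ for $k=1,\dots,K$, and let $x(t)$ be the inhomogeneous symmetric simple exclusion process with open boundaries on $G=\{0,1,\dots,K\}^N$ with these rates. Then the average sojourn time $U_k$ in the system of a particle of type $k$ is $$U_k=\frac{N}{2\beta_k},\quad k=1,\dots,K.$$
   Context: The process: $x(t)=(x_1(t),\dots,x_N(t))$, $t\ge0$, is a continuous-time Markov chain with finite state space $G=\{0,1,\dots,K\}^N$. Sites are numbered $1,\dots,N$ from left to right; $x_i=0$ means that site $i$ is vacant, and $x_i=k\in\{1,\dots,K\}$ means that site $i$ is occupied by a particle of type $k$. The transitions and their rates are, for each $k=1,\dots,K$: (arrival) for $i=1$ and for $i=N$, if $x_i=0$, then $x_i$ changes to $k$ at rate $\alpha_k$ (a particle of type $k$ enters from outside); (departure) for $i=1$ and for $i=N$, if $x_i=k$, then $x_i$ changes to $0$ at rate $\beta_k$ (the particle leaves the system); (hop) for any two adjacent sites $i,j\in\{1,\dots,N\}$, $|i-j|=1$, if $x_i=k$ and $x_j=0$, then the particle in site $i$ moves to site $j$ (so $x_i$ becomes $0$ and $x_j$ becomes $k$) at rate $\delta_k$. No other transitions occur. Sojourn time: the sojourn time of a particle is the length of time between the moment it enters the system from outside (at site $1$ or $N$) and the moment it leaves the system (from site $1$ or $N$), the particle being followed through its hops. $U_k$ is the average sojourn time of particles of type $k$ in the stationary mode, in the usual queueing-theoretic sense (as in Little's formula): the long-run average over successive entering particles of type $k$, i.e. the almost sure limit as $n\to\infty$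 of the arithmetic mean of the sojourn times of the first $n$ particles of type $k$ that enter the system. *)

theory Defs
  imports "HOL-Probability.Probability" "HOL-Library.Infinite_Set"
begin

section \<open>Continuous-time Markov chains on a finite state space\<close>

text \<open>
  Jump times of a right-continuous path \<open>p\<close>. If the path never leaves the state it is in at
  the \<open>n\<close>-th jump time, that jump time is repeated; for the chains below this is a null event.
\<close>

primrec jump_time :: "(real \<Rightarrow> 's) \<Rightarrow> nat \<Rightarrow> real" where
  "jump_time p 0 = 0"
| "jump_time p (Suc n) =
     (if \<exists>t > jump_time p n. p t \<noteq> p (jump_time p n)
      then Inf {t. t > jump_time p n \<and> p t \<noteq> p (jump_time p n)}
      else jump_time p n)"

definition jump_state :: "(real \<Rightarrow> 's) \<Rightarrow> nat \<Rightarrow> 's" where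
  "jump_state p n = p (jump_time p n)"

definition holding_time :: "(real \<Rightarrow> 's) \<Rightarrow> nat \<Rightarrow> real" where
  "holding_time p n = jump_time p (Suc n) - jump_time p n"

definition exit_rate :: "'s set \<Rightarrow> ('s \<Rightarrow> 's \<Rightarrow> real) \<Rightarrow> 's \<Rightarrow> real" where
  "exit_rate G Q s = (\<Sum>s' \<in> G - {s}. Q s s')"

definition jump_prob :: "'s set \<Rightarrow> ('s \<Rightarrow> 's \<Rightarrow> real) \<Rightarrow> 's \<Rightarrow> 's \<Rightarrow> real" where
  "jump_prob G Q s s' = (if s' = s then 0 else Q s s' / exit_rate G Q s)"

text \<open>
  \<open>x\<close> is a continuous-time Markov chain on the finite set \<open>G\<close> with transition rates \<open>Q\<close> and
  arbitrary initial distribution, in the jump chain / holding time sense: the jump chain is a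
  discrete-time Markov chain with transition matrix \<open>jump_prob G Q\<close>, and conditionally on it the
  holding times are independent, the one spent in a state \<open>s\<close> being exponential with parameter
  \<open>exit_rate G Q s\<close>. The assumption \<open>jump_chain_holding_times\<close> is the joint law these two
  requirements amount to.

  The definition is meant for chains without absorbing states (all exit rates positive).
  Measurability of the jump chain and of the holding times follows from measurability and
  right-continuity of \<open>x\<close>; it is listed only for convenience.
\<close>

locale finite_ctmc = prob_space M
  for M :: "'w measure" and G :: "'s set" and Q :: "'s \<Rightarrow> 's \<Rightarrow> real"
    and x :: "real \<Rightarrow> 'w \<Rightarrow> 's" +
  assumes finite_states: "finite G"
    and random_state: "\<And>t. t \<ge> 0 \<Longrightarrow> x t \<in> measurable M (count_space G)"
    and right_continuous:
      "\<And>\<omega> t. \<omega> \<in> space M \<Longrightarrow> t \<ge> 0 \<Longrightarrow> eventually (\<lambda>s. x s \<omega> = x t \<omega>) (at_right t)"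
    and random_jump_state:
      "\<And>n. (\<lambda>\<omega>. jump_state (\<lambda>t. x t \<omega>) n) \<in> measurable M (count_space G)"
    and random_holding_time:
      "\<And>n. (\<lambda>\<omega>. holding_time (\<lambda>t. x t \<omega>) n) \<in> borel_measurable M"
    and jump_chain_holding_times:
      "\<And>n (s :: nat \<Rightarrow> 's) (u :: nat \<Rightarrow> real).
         (\<And>i. i \<le> n \<Longrightarrow> s i \<in> G) \<Longrightarrow> (\<And>i. i \<le> n \<Longrightarrow> u i \<ge> 0) \<Longrightarrow>
         measure M {\<omega> \<in> space M. \<forall>i \<le> n. jump_state (\<lambda>t. x t \<omega>) i = s i
                                        \<and> holding_time (\<lambda>t. x t \<omega>) i > u i}
         = measure M {\<omega> \<in> space M. x 0 \<omega> = s 0}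
           * (\<Prod>i<n. jump_prob G Q (s i) (s (Suc i)))
           * (\<Prod>i\<le>n. exp (- exit_rate G Q (s i) * u i))"


section \<open>The exclusion process with open boundaries\<close>

text \<open>A configuration maps each site in \<open>{1..N}\<close> to \<open>0\<close> (vacant) or to a particle type.\<close>

type_synonym config = "nat \<Rightarrow> nat"

definition configs :: "nat \<Rightarrow> nat \<Rightarrow> config set" where
  "configs N K = {1..N} \<rightarrow>\<^sub>E {0..K}"

text \<open>
  The three kinds of transitions from \<open>c\<close> to \<open>c'\<close>, for a particle of type \<open>k\<close>. For \<open>N \<ge> 2\<close> and
  \<open>k \<ge> 1\<close> the pair \<open>c\<close>, \<open>c'\<close> determines the kind of transition, the type and the sites involved,
  so particles can be followed along the path of the process.
\<close>

definition arrives :: "nat \<Rightarrow> nat \<Rightarrow> nat \<Rightarrow> config \<Rightarrow> config \<Rightarrow> bool" where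
  "arrives N k i c c' \<longleftrightarrow> i \<in> {1, N} \<and> c i = 0 \<and> c' = c(i := k)"

definition departs :: "nat \<Rightarrow> nat \<Rightarrow> nat \<Rightarrow> config \<Rightarrow> config \<Rightarrow> bool" where
  "departs N k i c c' \<longleftrightarrow> i \<in> {1, N} \<and> c i = k \<and> c' = c(i := 0)"

definition hops :: "nat \<Rightarrow> nat \<Rightarrow> nat \<Rightarrow> nat \<Rightarrow> config \<Rightarrow> config \<Rightarrow> bool" where
  "hops N k i j c c' \<longleftrightarrow>
     i \<in> {1..N} \<and> j \<in> {1..N} \<and> (j = i + 1 \<or> i = j + 1) \<and>
     c i = k \<and> c j = 0 \<and> c' = c(i := 0, j := k)"

definition exclusion_rate ::
    "nat \<Rightarrow> nat \<Rightarrow> (nat \<Rightarrow> real) \<Rightarrow> (nat \<Rightarrow> real) \<Rightarrow> (nat \<Rightarrow> real) \<Rightarrow> config \<Rightarrow> config \<Rightarrow> real" where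
  "exclusion_rate N K \<alpha> \<beta> \<delta> c c' =
     (\<Sum>k = 1..K.
        (\<Sum>i \<in> {1, N}. (if arrives N k i c c' then \<alpha> k else 0)
                     + (if departs N k i c c' then \<beta> k else 0))
      + (\<Sum>i = 1..N. \<Sum>j = 1..N. if hops N k i j c c' then \<delta> k else 0))"


section \<open>Sojourn times\<close>

text \<open>
  Transition number \<open>n\<close> of a path leads from \<open>jump_state p n\<close> to \<open>jump_state p (Suc n)\<close> and
  happens at time \<open>jump_time p (Suc n)\<close>. A particle is identified by its type and the number of the
  transition by which it enters.
\<close>

definition entries :: "nat \<Rightarrow> nat \<Rightarrow> (real \<Rightarrow> config) \<Rightarrow> nat set" where
  "entries N k p = {n. \<exists>i. arrives N k i (jump_state p n) (jump_state p (Suc n))}"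

text \<open>Where a particle at site \<open>i\<close> is after a transition; \<open>None\<close> means outside the system.\<close>

definition next_site :: "nat \<Rightarrow> config \<Rightarrow> config \<Rightarrow> nat \<Rightarrow> nat option" where
  "next_site N c c' i =
     (if departs N (c i) i c c' then None
      else if \<exists>j. hops N (c i) i j c c' then Some (THE j. hops N (c i) i j c c')
      else Some i)"

text \<open>
  The site, after transition \<open>n + m\<close>, of the particle of type \<open>k\<close> that entered in transition \<open>n\<close>.
\<close>

primrec particle_site :: "nat \<Rightarrow> nat \<Rightarrow> (real \<Rightarrow> config) \<Rightarrow> nat \<Rightarrow> nat \<Rightarrow> nat option" where
  "particle_site N k p n 0 = Some (THE i. arrives N k i (jump_state p n) (jump_state p (Suc n)))"
| "particle_site N k p n (Suc m) =
     (case particle_site N k p n m of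
        None \<Rightarrow> None
      | Some i \<Rightarrow> next_site N (jump_state p (Suc (n + m))) (jump_state p (Suc (Suc (n + m)))) i)"

definition sojourn_time :: "nat \<Rightarrow> nat \<Rightarrow> (real \<Rightarrow> config) \<Rightarrow> nat \<Rightarrow> ereal" where
  "sojourn_time N k p n =
     (if \<exists>m. particle_site N k p n m = None
      then ereal (jump_time p (Suc (n + (LEAST m. particle_site N k p n m = None)))
                  - jump_time p (Suc n))
      else \<infinity>)"

definition mean_sojourn_time :: "nat \<Rightarrow> nat \<Rightarrow> (real \<Rightarrow> config) \<Rightarrow> nat \<Rightarrow> ereal" where
  "mean_sojourn_time N k p n =
     (\<Sum>j<n. sojourn_time N k p (enumerate (entries N k p) j)) / ereal (real n)"

text \<open>
  \<open>U\<close> is the long-run average sojourn time of particles of type \<open>k\<close>. Infinitely many entries are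
  required because \<open>enumerate\<close> is meaningful for all indices only on infinite sets.
\<close>

definition has_average_sojourn_time ::
    "'w measure \<Rightarrow> nat \<Rightarrow> (real \<Rightarrow> 'w \<Rightarrow> config) \<Rightarrow> nat \<Rightarrow> real \<Rightarrow> bool" where
  "has_average_sojourn_time M N x k U \<longleftrightarrow>
     (AE \<omega> in M. infinite (entries N k (\<lambda>t. x t \<omega>)) \<and>
        (\<lambda>n. mean_sojourn_time N k (\<lambda>t. x t \<omega>) n) \<longlonglongrightarrow> ereal U)"

end

theory Submission
  imports Defs "HOL-Real_Asymp.Real_Asymp"
begin

text \<open>
  The product weights \<open>w c = (\<Prod>i. \<rho> (c i))\<close> with \<open>\<rho> 0 = 1\<close> and \<open>\<rho> k = \<alpha> k / \<beta> k\<close> satisfy detailed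
  balance, since a hop permutes the factors. Under the normalised weights a site holds a particle
  of type \<open>k\<close> with probability proportional to \<open>\<rho> k\<close> and is vacant with probability proportional to
  \<open>1\<close>, so Little's formula gives \<open>U k = N * \<rho> k / (2 * \<alpha> k) = N / (2 * \<beta> k)\<close>.

  The ergodic averages are obtained without a general ergodic theorem. Transition counts and holding
  times, minus their conditional expectations, are uncorrelated with bounded second moments, so
  their averages vanish almost surely. Hence the visit frequencies are asymptotically stationary,
  and by reversibility the Dirichlet form of their density with respect to the stationary weights
  tends to \<open>0\<close>, which forces this density to become constant.

  Little's formula is then pathwise: once the system has been empty, the number of followed particles
  of type \<open>k\<close> is the number of sites in state \<open>k\<close>, and all particles that entered before transition
  \<open>m\<close> have left at the next visit to the empty configuration, whose index is \<open>m + o(m)\<close>.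
\<close>

text \<open>The law of the chain is given only through joint tails of finitely many states and
  holding times, and the initial distribution is arbitrary, so a path need not start in the
  stationary mode. What such tails yield directly are mixed second moments, by integration over the
  thresholds. These suffice for a strong law along the squares, and one-sided control of the
  increments fills the gaps between squares.

  Detailed balance does more than identify the limit: it turns convergence of the visit frequencies
  into an estimate for a sum of squares along each single path, so neither compactness nor
  uniqueness of the stationary law has to be invoked.

  All averages are taken per transition and not per unit of time. The mean length of a transition is
  absorbed in the constant \<open>\<kappa>\<close>, which occurs in the mean occupation and in the
  entry frequency alike and cancels in their quotient.\<close>

section \<open>A strong law for uncorrelated variables\<close>

text \<open>The sums of \<open>a\<close> only grow and those of \<open>b\<close> grow by at most
  \<open>B\<close> per step. Between two consecutive squares the difference is therefore enclosed by
  its values at these squares, up to an error of order \<open>j\<close> that is negligible against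
  the square of \<open>j\<close>. Only \<open>b\<close> is bounded, because \<open>a\<close> may be
  a holding time.\<close>

lemma cesaro_interpolation:
  fixes a b :: "nat \<Rightarrow> real"
  assumes a: "\<And>i. a i \<ge> 0" and b: "\<And>i. b i \<ge> 0" "\<And>i. b i \<le> B"
    and sq: "(\<lambda>j. (\<Sum>i<(Suc j)\<^sup>2. a i - b i) / real ((Suc j)\<^sup>2)) \<longlonglongrightarrow> 0"
  shows "(\<lambda>m. (\<Sum>i<m. a i - b i) / real m) \<longlonglongrightarrow> 0"
proof -
  define S where "S = (\<lambda>m. \<Sum>i<m. a i - b i)"
  define f where "f = (\<lambda>j. \<bar>S ((Suc j)\<^sup>2)\<bar> / real ((Suc j)\<^sup>2))"
  \<comment> \<open>\<open>f j\<close> belongs to the square of \<open>Suc j\<close>, so that no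
    denominator vanishes. Hence the shift: for \<open>m \<ge> 1\<close>, \<open>Suc (r m)\<close> is
    the integer part of \<open>sqrt m\<close>, and \<open>f (r m)\<close> and
    \<open>f (Suc (r m))\<close> belong to the two squares enclosing \<open>m\<close>.\<close>
  define r where "r = (\<lambda>m. nat \<lfloor>sqrt (real m)\<rfloor> - 1)"
  have f0: "f \<longlonglongrightarrow> 0"
    using tendsto_rabs_zero[OF sq] by (simp add: f_def S_def abs_divide)
  have B0: "B \<ge> 0"
    using b(1)[of 0] b(2)[of 0] by linarith
  have lower: "S n - S m \<ge> - (B * real (n - m))"
    if "m \<le> n" for m n
  proof -
    have split: "S n = S m + (\<Sum>i\<in>{m..<n}. a i) - (\<Sum>i\<in>{m..<n}. b i)"
    proof -
      have "S n = S m + (\<Sum>i\<in>{m..<n}. a i - b i)"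
        unfolding S_def by (metis lessThan_atLeast0 sum.atLeastLessThan_concat that zero_le)
      then show ?thesis by (simp add: sum_subtractf)
    qed
    have "(\<Sum>i\<in>{m..<n}. b i) \<le> (\<Sum>i\<in>{m..<n}. B)"
      by (intro sum_mono b)
    moreover have "(\<Sum>i\<in>{m..<n}. a i) \<ge> 0"
      by (intro sum_nonneg a)
    ultimately show ?thesis
      using split by (simp add: mult.commute)
  qed
  have bound: "\<bar>S m / real m\<bar> \<le> f (r m) + 4 * f (Suc (r m)) + 3 * B / real (Suc (r m))"
    if "m \<ge> 1" for m
  proof -
    define j where "j = Suc (r m)"
    have sm: "sqrt (real m) \<ge> 1" using that by simp
    have jr: "real j = of_int \<lfloor>sqrt (real m)\<rfloor>"
      using sm unfolding j_def r_def by simp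
    have "real j \<le> sqrt (real m)" "sqrt (real m) < real j + 1"
      unfolding jr by linarith+
    then have "(real j)\<^sup>2 \<le> (sqrt (real m))\<^sup>2" "(sqrt (real m))\<^sup>2 < (real j + 1)\<^sup>2"
      by (intro power_mono power_strict_mono; simp)+
    then have "real (j\<^sup>2) \<le> real m" "real m < real ((j + 1)\<^sup>2)"
      by (simp_all add: add.commute)
    then have j1: "j\<^sup>2 \<le> m" and j2: "m \<le> (Suc j)\<^sup>2"
      by (simp_all only: of_nat_le_iff of_nat_less_iff) simp
    have jpos: "real j \<ge> 1" unfolding j_def by simp
    have d1: "m - j\<^sup>2 \<le> 3 * j" "(Suc j)\<^sup>2 - m \<le> 3 * j"
      using j1 j2 jpos by (auto simp: power2_eq_square algebra_simps)
    have e1: "B * real (m - j\<^sup>2) \<le> B * (3 * real j)" "B * real ((Suc j)\<^sup>2 - m) \<le> B * (3 * real j)"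
      using d1 B0 by (auto intro!: mult_left_mono simp flip: of_nat_mult)
    have l: "S m \<ge> S (j\<^sup>2) - B * (3 * real j)"
      using lower[OF j1] e1 by linarith
    have u: "S m \<le> S ((Suc j)\<^sup>2) + B * (3 * real j)"
      using lower[OF j2] e1 by linarith
    have "\<bar>S m\<bar> \<le> \<bar>S (j\<^sup>2)\<bar> + \<bar>S ((Suc j)\<^sup>2)\<bar> + 3 * B * real j"
      using l u B0 jpos by (auto simp: abs_le_iff)
    moreover have "\<bar>S m\<bar> / real m \<le> \<bar>S m\<bar> / real (j\<^sup>2)"
      using j1 jpos that by (intro divide_left_mono) (auto simp flip: of_nat_power)
    ultimately have "\<bar>S m\<bar> / real m \<le> (\<bar>S (j\<^sup>2)\<bar> + \<bar>S ((Suc j)\<^sup>2)\<bar> + 3 * B * real j) / real (j\<^sup>2)"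
      by (meson divide_right_mono of_nat_0_le_iff order_trans)
    also have "\<dots> = f (r m) + \<bar>S ((Suc j)\<^sup>2)\<bar> / real (j\<^sup>2) + 3 * B / real j"
    proof -
      have "f (r m) = \<bar>S (j\<^sup>2)\<bar> / real (j\<^sup>2)"
        by (simp only: f_def j_def)
      then show ?thesis
        using jpos by (simp add: add_divide_distrib power2_eq_square)
    qed
    \<comment> \<open>The denominator of \<open>f j\<close> is the square of \<open>Suc j\<close>,
      at most four times that of \<open>j\<close> because \<open>j \<ge> 1\<close>.\<close>
    also have "\<bar>S ((Suc j)\<^sup>2)\<bar> / real (j\<^sup>2) \<le> 4 * f j"
    proof -
      have "real ((Suc j)\<^sup>2) \<le> 4 * real (j\<^sup>2)"
      proof -
        have "(real (Suc j))\<^sup>2 \<le> (2 * real j)\<^sup>2" using jpos by (intro power_mono) auto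
        then show ?thesis by (simp add: power_mult_distrib)
      qed
      then have "\<bar>S ((Suc j)\<^sup>2)\<bar> * real ((Suc j)\<^sup>2) \<le> \<bar>S ((Suc j)\<^sup>2)\<bar> * (4 * real (j\<^sup>2))"
        by (intro mult_left_mono) auto
      then show ?thesis
        using jpos unfolding f_def by (simp add: field_simps del: of_nat_power of_nat_Suc)
    qed
    finally show ?thesis
      using that by (simp add: j_def abs_divide)
  qed
  have sr: "filterlim r at_top at_top"
  proof -
    have "filterlim (\<lambda>m. nat \<lfloor>sqrt (real m)\<rfloor>) at_top sequentially"
      by (intro filterlim_compose[OF filterlim_nat_sequentially]
          filterlim_compose[OF filterlim_floor_sequentially]
          filterlim_compose[OF sqrt_at_top filterlim_real_sequentially])
    then show ?thesis
      unfolding r_def by (rule filterlim_compose[OF filterlim_minus_const_nat_at_top])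
  qed
  have "(\<lambda>j. f j + 4 * f (Suc j) + 3 * B / real (Suc j)) \<longlonglongrightarrow> 0 + 4 * 0 + 0"
    by (intro tendsto_intros f0 LIMSEQ_Suc lim_const_over_n)
  then have "(\<lambda>m. f (r m) + 4 * f (Suc (r m)) + 3 * B / real (Suc (r m))) \<longlonglongrightarrow> 0"
    using filterlim_compose[OF _ sr] by force
  then have "(\<lambda>m. S m / real m) \<longlonglongrightarrow> 0"
    by (rule Lim_null_comparison[rotated])
      (use bound in \<open>auto intro!: eventually_sequentiallyI[of 1]\<close>)
  then show ?thesis by (simp add: S_def)
qed

context prob_space begin

text \<open>Orthogonality bounds the second moment of the \<open>n\<close>-th mean by
  \<open>C / n\<close>, which is summable along the squares. So the squared means have a finite sum
  almost surely, and hence tend to 0.\<close>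

lemma uncorrelated_squares_AE:
  fixes D :: "nat \<Rightarrow> 'a \<Rightarrow> real"
  assumes [measurable]: "\<And>i. D i \<in> borel_measurable M"
    and int: "\<And>i j. integrable M (\<lambda>\<omega>. D i \<omega> * D j \<omega>)"
    and orth: "\<And>i j. i < j \<Longrightarrow> expectation (\<lambda>\<omega>. D i \<omega> * D j \<omega>) = 0"
    and sq: "\<And>i. expectation (\<lambda>\<omega>. D i \<omega> * D i \<omega>) \<le> C"
  shows "AE \<omega> in M. (\<lambda>j. (\<Sum>i<(Suc j)\<^sup>2. D i \<omega>) / real ((Suc j)\<^sup>2)) \<longlonglongrightarrow> 0"
proof -
  define S where "S = (\<lambda>n \<omega>. \<Sum>i<n. D i \<omega>)"
  have [measurable]: "S n \<in> borel_measurable M" for n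
    unfolding S_def by measurable
  have S2: "S n \<omega> * S n \<omega> = (\<Sum>i<n. \<Sum>j<n. D i \<omega> * D j \<omega>)" for n \<omega>
    by (simp add: S_def sum_product)
  have intS: "integrable M (\<lambda>\<omega>. S n \<omega> * S n \<omega>)" for n
    unfolding S2 by (intro Bochner_Integration.integrable_sum int)
  have orth': "expectation (\<lambda>\<omega>. D i \<omega> * D j \<omega>) = 0" if "i \<noteq> j" for i j
    using that orth[of i j] orth[of j i] by (cases "i < j") (auto simp: mult.commute)
  have C0: "C \<ge> 0"
  proof -
    have "0 \<le> expectation (\<lambda>\<omega>. D 0 \<omega> * D 0 \<omega>)"
      by (rule integral_nonneg_AE) simp
    then show ?thesis using sq[of 0] by linarith
  qed
  have ES: "expectation (\<lambda>\<omega>. S n \<omega> * S n \<omega>) \<le> real n * C" for n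
  proof -
    have "expectation (\<lambda>\<omega>. S n \<omega> * S n \<omega>) = (\<Sum>i<n. \<Sum>j<n. expectation (\<lambda>\<omega>. D i \<omega> * D j \<omega>))"
      unfolding S2 by (simp add: int)
    also have "\<dots> = (\<Sum>i<n. \<Sum>j<n. if i = j then expectation (\<lambda>\<omega>. D i \<omega> * D i \<omega>) else 0)"
      by (intro sum.cong refl) (auto simp: orth')
    also have "\<dots> = (\<Sum>i<n. expectation (\<lambda>\<omega>. D i \<omega> * D i \<omega>))"
      by simp
    also have "\<dots> \<le> (\<Sum>i<n. C)"
      by (intro sum_mono sq)
    finally show ?thesis by simp
  qed
  define g where "g = (\<lambda>j \<omega>. (S ((Suc j)\<^sup>2) \<omega> / real ((Suc j)\<^sup>2))\<^sup>2)"
  have [measurable]: "g j \<in> borel_measurable M" for j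
    unfolding g_def by measurable
  have gint: "(\<integral>\<^sup>+\<omega>. ennreal (g j \<omega>) \<partial>M) \<le> ennreal (C / real ((Suc j)\<^sup>2))" for j
  proof -
    let ?n = "(Suc j)\<^sup>2"
    have geq: "g j \<omega> = (S ?n \<omega> * S ?n \<omega>) / (real ?n * real ?n)" for \<omega>
      unfolding g_def power2_eq_square by (simp add: field_simps)
    have "integrable M (g j)"
      unfolding geq[abs_def] by (intro integrable_divide intS)
    then have "(\<integral>\<^sup>+\<omega>. ennreal (g j \<omega>) \<partial>M) = ennreal (expectation (g j))"
      by (intro nn_integral_eq_integral) (auto simp: g_def)
    also have "expectation (g j) = expectation (\<lambda>\<omega>. S ?n \<omega> * S ?n \<omega>) / (real ?n * real ?n)"
      unfolding geq[abs_def] by simp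
    also have "\<dots> \<le> (real ?n * C) / (real ?n * real ?n)"
      by (intro divide_right_mono ES) simp
    also have "\<dots> = C / real ?n"
      by (simp del: of_nat_power of_nat_Suc)
    finally show ?thesis by (simp add: ennreal_leI del: of_nat_power of_nat_Suc)
  qed
  have summ: "summable (\<lambda>j. C / real ((Suc j)\<^sup>2))"
  proof -
    have "summable (\<lambda>j. 1 / (real (Suc j))\<^sup>2)"
      using inverse_power_summable[of 2, where 'a = real]
      by (subst summable_Suc_iff) (simp add: inverse_eq_divide)
    from summable_mult[OF this, of C] show ?thesis by simp
  qed
  have "(\<integral>\<^sup>+\<omega>. (\<Sum>j. ennreal (g j \<omega>)) \<partial>M) = (\<Sum>j. \<integral>\<^sup>+\<omega>. ennreal (g j \<omega>) \<partial>M)"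
    by (intro nn_integral_suminf) measurable
  also have "\<dots> \<le> (\<Sum>j. ennreal (C / real ((Suc j)\<^sup>2)))"
    by (intro suminf_le gint summableI)
  also have "\<dots> = ennreal (\<Sum>j. C / real ((Suc j)\<^sup>2))"
    using C0 by (intro suminf_ennreal2 summ) auto
  also have "\<dots> < \<infinity>" by simp
  finally have "AE \<omega> in M. (\<Sum>j. ennreal (g j \<omega>)) \<noteq> \<infinity>"
    by (intro nn_integral_noteq_infinite) auto
  then show ?thesis
  proof eventually_elim
    case (elim \<omega>)
    have "summable (\<lambda>j. g j \<omega>)"
      using elim by (intro summable_suminf_not_top) (auto simp: g_def)
    then have "(\<lambda>j. g j \<omega>) \<longlonglongrightarrow> 0"
      by (rule summable_LIMSEQ_zero)
    then have "(\<lambda>j. S ((Suc j)\<^sup>2) \<omega> / real ((Suc j)\<^sup>2)) \<longlonglongrightarrow> 0"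
      unfolding g_def by (simp add: tendsto_null_power)
    then show ?case by (simp add: S_def)
  qed
qed

text \<open>In the applications \<open>b i\<close> is a conditional expectation of
  \<open>a i\<close>, and it is bounded even where \<open>a i\<close> is not.\<close>

lemma strong_law_uncorrelated:
  fixes a b :: "nat \<Rightarrow> 'a \<Rightarrow> real"
  assumes "\<And>i. a i \<in> borel_measurable M" "\<And>i. b i \<in> borel_measurable M"
    and a: "\<And>i \<omega>. a i \<omega> \<ge> 0" and b: "\<And>i \<omega>. b i \<omega> \<ge> 0" "\<And>i \<omega>. b i \<omega> \<le> B"
    and "\<And>i j. integrable M (\<lambda>\<omega>. (a i \<omega> - b i \<omega>) * (a j \<omega> - b j \<omega>))"
    and "\<And>i j. i < j \<Longrightarrow> expectation (\<lambda>\<omega>. (a i \<omega> - b i \<omega>) * (a j \<omega> - b j \<omega>)) = 0"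
    and "\<And>i. expectation (\<lambda>\<omega>. (a i \<omega> - b i \<omega>) * (a i \<omega> - b i \<omega>)) \<le> C"
  shows "AE \<omega> in M. (\<lambda>m. (\<Sum>i<m. a i \<omega> - b i \<omega>) / real m) \<longlonglongrightarrow> 0"
proof -
  have "AE \<omega> in M. (\<lambda>j. (\<Sum>i<(Suc j)\<^sup>2. a i \<omega> - b i \<omega>) / real ((Suc j)\<^sup>2)) \<longlonglongrightarrow> 0"
    using assms by (intro uncorrelated_squares_AE[where C = C]) auto
  then show ?thesis
    by eventually_elim (intro cesaro_interpolation[where B = B] a b)
qed

text \<open>Each factor is the length of the interval of thresholds that it exceeds, and Tonelli
  moves the expectation inside. This converts the tails in which \<open>finite_ctmc\<close> is
  phrased into mixed second moments.\<close>

lemma nn_integral_layer_cake2: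
  fixes f g :: "'a \<Rightarrow> real"
  assumes [measurable]: "f \<in> borel_measurable M" "g \<in> borel_measurable M"
    and nonneg: "\<And>\<omega>. f \<omega> \<ge> 0" "\<And>\<omega>. g \<omega> \<ge> 0"
  shows "(\<integral>\<^sup>+\<omega>. ennreal (f \<omega> * g \<omega>) \<partial>M) =
    (\<integral>\<^sup>+u. \<integral>\<^sup>+v. ennreal (prob {\<omega> \<in> space M. f \<omega> > u \<and> g \<omega> > v})
       * indicator {0..} u * indicator {0..} v \<partial>lborel \<partial>lborel)"
proof -
  interpret P: pair_sigma_finite M lborel ..
  let ?I = "\<lambda>\<omega> u v. of_bool (0 \<le> u \<and> u < f \<omega>) * of_bool (0 \<le> v \<and> v < g \<omega>) :: ennreal"
  have len: "ennreal t = (\<integral>\<^sup>+u. of_bool (0 \<le> u \<and> u < t) \<partial>lborel)" if "t \<ge> 0" for t :: real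
  proof -
    have "(\<integral>\<^sup>+u. of_bool (0 \<le> u \<and> u < t) \<partial>lborel) = (\<integral>\<^sup>+u. indicator {0..<t} u \<partial>lborel)"
      by (intro nn_integral_cong) (auto simp: indicator_def)
    then show ?thesis using that by simp
  qed
  have "(\<integral>\<^sup>+\<omega>. ennreal (f \<omega> * g \<omega>) \<partial>M) = (\<integral>\<^sup>+\<omega>. \<integral>\<^sup>+u. \<integral>\<^sup>+v. ?I \<omega> u v \<partial>lborel \<partial>lborel \<partial>M)"
    by (simp add: ennreal_mult nonneg len[OF nonneg(1)] len[OF nonneg(2)] nn_integral_cmult nn_integral_multc)
  also have "\<dots> = (\<integral>\<^sup>+u. \<integral>\<^sup>+\<omega>. \<integral>\<^sup>+v. ?I \<omega> u v \<partial>lborel \<partial>M \<partial>lborel)"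
    by (intro P.Fubini'[symmetric]) measurable
  also have "\<dots> = (\<integral>\<^sup>+u. \<integral>\<^sup>+v. \<integral>\<^sup>+\<omega>. ?I \<omega> u v \<partial>M \<partial>lborel \<partial>lborel)"
    by (intro nn_integral_cong P.Fubini'[symmetric]) measurable
  also have "\<dots> = (\<integral>\<^sup>+u. \<integral>\<^sup>+v. ennreal (prob {\<omega> \<in> space M. f \<omega> > u \<and> g \<omega> > v})
       * indicator {0..} u * indicator {0..} v \<partial>lborel \<partial>lborel)"
  proof (intro nn_integral_cong)
    fix u v :: real
    have "(\<integral>\<^sup>+\<omega>. ?I \<omega> u v \<partial>M) =
        (\<integral>\<^sup>+\<omega>. indicator {\<omega> \<in> space M. f \<omega> > u \<and> g \<omega> > v} \<omega> * (indicator {0..} u * indicator {0..} v) \<partial>M)"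
      by (intro nn_integral_cong) (auto simp: indicator_def)
    also have "\<dots> = emeasure M {\<omega> \<in> space M. f \<omega> > u \<and> g \<omega> > v} * (indicator {0..} u * indicator {0..} v)"
      by (simp add: nn_integral_multc)
    finally show "(\<integral>\<^sup>+\<omega>. ?I \<omega> u v \<partial>M) = ennreal (prob {\<omega> \<in> space M. f \<omega> > u \<and> g \<omega> > v})
       * indicator {0..} u * indicator {0..} v"
      by (simp add: emeasure_eq_measure mult.assoc)
  qed
  finally show ?thesis .
qed

end

lemma nn_integral_exp_tail:
  fixes q :: real
  assumes "q > 0"
  shows "(\<integral>\<^sup>+u. ennreal (exp (- q * u)) * indicator {0..} u \<partial>lborel) = ennreal (1 / q)"
proof -
  have "(\<integral>\<^sup>+u. ennreal (exp (- q * u)) * indicator {0..} u \<partial>lborel) = ennreal (0 - (- exp (- q * 0) / q))"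
  proof (rule nn_integral_FTC_atLeast)
    show "((\<lambda>u. - exp (- q * u) / q) \<longlongrightarrow> 0) at_top"
      using assms by real_asymp
  qed (use assms in \<open>auto intro!: derivative_eq_intros\<close>)
  then show ?thesis by simp
qed

section \<open>Frequencies along a Markov jump process\<close>

lemma holding_time_nonneg: "holding_time p n \<ge> 0"
  unfolding holding_time_def by (auto intro!: cInf_greatest)

lemma jump_time_eq_sum: "jump_time p n = (\<Sum>i<n. holding_time p i)"
  unfolding holding_time_def by (induction n) (auto simp del: jump_time.simps(2))

locale nonabsorbing_ctmc = finite_ctmc +
  assumes rate_nonneg: "\<And>c d. c \<in> G \<Longrightarrow> d \<in> G \<Longrightarrow> Q c d \<ge> 0"
    and exit_rate_pos: "\<And>c. c \<in> G \<Longrightarrow> exit_rate G Q c > 0"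
begin

abbreviation Y :: "nat \<Rightarrow> 'a \<Rightarrow> 'b" where
  "Y n \<omega> \<equiv> jump_state (\<lambda>t. x t \<omega>) n"

abbreviation H :: "nat \<Rightarrow> 'a \<Rightarrow> real" where
  "H n \<omega> \<equiv> holding_time (\<lambda>t. x t \<omega>) n"

abbreviation q :: "'b \<Rightarrow> real" where "q \<equiv> exit_rate G Q"

abbreviation p :: "'b \<Rightarrow> 'b \<Rightarrow> real" where "p \<equiv> jump_prob G Q"

declare random_jump_state [measurable] random_holding_time [measurable]

lemma Y_in: "\<omega> \<in> space M \<Longrightarrow> Y n \<omega> \<in> G"
  using measurable_space[OF random_jump_state] by simp

lemma pred_Y [measurable]: "Measurable.pred M (\<lambda>\<omega>. P (Y n \<omega>))"
  by (rule measurable_compose[OF random_jump_state]) simp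

lemma jump_prob_nonneg: "c \<in> G \<Longrightarrow> d \<in> G \<Longrightarrow> p c d \<ge> 0"
  using rate_nonneg exit_rate_pos[of c] by (auto simp: jump_prob_def)

lemma sum_jump_prob:
  assumes "c \<in> G" shows "(\<Sum>d\<in>G. p c d) = 1"
proof -
  have "(\<Sum>d\<in>G. p c d) = (\<Sum>d\<in>G - {c}. p c d)"
    using assms finite_states by (subst sum.remove[of G c]) (auto simp: jump_prob_def)
  also have "\<dots> = (\<Sum>d\<in>G - {c}. Q c d / q c)"
    by (intro sum.cong) (auto simp: jump_prob_def)
  also have "\<dots> = q c / q c"
    by (simp add: exit_rate_def flip: sum_divide_distrib)
  finally show ?thesis using exit_rate_pos[OF assms] by simp
qed

text \<open>Restriction to \<open>{..n}\<close> leaves only finitely many possible paths.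
  \<open>B\<close> is kept free so that it can speak of holding times or of a later state.\<close>

lemma prob_path_decomposition:
  assumes [measurable]: "Measurable.pred M B"
  shows "prob {\<omega> \<in> space M. \<Phi> (\<lambda>i\<in>{..n}. Y i \<omega>) \<and> B \<omega>} =
    (\<Sum>s | s \<in> {..n} \<rightarrow>\<^sub>E G \<and> \<Phi> s. prob {\<omega> \<in> space M. (\<forall>i\<le>n. Y i \<omega> = s i) \<and> B \<omega>})"
proof -
  let ?I = "{s. s \<in> {..n} \<rightarrow>\<^sub>E G \<and> \<Phi> s}"
  let ?E = "\<lambda>s. {\<omega> \<in> space M. (\<forall>i\<le>n. Y i \<omega> = s i) \<and> B \<omega>}"
  have eq: "(\<lambda>i\<in>{..n}. Y i \<omega>) = s \<longleftrightarrow> (\<forall>i\<le>n. Y i \<omega> = s i)" if "s \<in> {..n} \<rightarrow>\<^sub>E G" for s \<omega>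
    using that by (auto simp: PiE_def extensional_def restrict_def fun_eq_iff)
  have restr: "(\<lambda>i\<in>{..n}. Y i \<omega>) \<in> {..n} \<rightarrow>\<^sub>E G" if "\<omega> \<in> space M" for \<omega>
    using Y_in[OF that] by auto
  have "{\<omega> \<in> space M. \<Phi> (\<lambda>i\<in>{..n}. Y i \<omega>) \<and> B \<omega>} = (\<Union>s\<in>?I. ?E s)"
  proof (intro equalityI subsetI)
    fix \<omega> assume "\<omega> \<in> {\<omega> \<in> space M. \<Phi> (\<lambda>i\<in>{..n}. Y i \<omega>) \<and> B \<omega>}"
    then show "\<omega> \<in> (\<Union>s\<in>?I. ?E s)"
      using restr[of \<omega>] by (intro UN_I[of "\<lambda>i\<in>{..n}. Y i \<omega>"]) auto
  next
    fix \<omega> assume "\<omega> \<in> (\<Union>s\<in>?I. ?E s)"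
    then obtain s where s: "s \<in> {..n} \<rightarrow>\<^sub>E G" "\<Phi> s" "\<omega> \<in> space M" "\<forall>i\<le>n. Y i \<omega> = s i" "B \<omega>"
      by blast
    with eq[OF s(1), of \<omega>] show "\<omega> \<in> {\<omega> \<in> space M. \<Phi> (\<lambda>i\<in>{..n}. Y i \<omega>) \<and> B \<omega>}"
      by auto
  qed
  moreover have "finite ?I"
    using finite_PiE[of "{..n}" "\<lambda>_. G"] finite_states by auto
  moreover have "disjoint_family_on ?E ?I"
  proof (unfold disjoint_family_on_def, intro ballI impI)
    fix s s' assume *: "s \<in> ?I" "s' \<in> ?I" "s \<noteq> s'"
    then obtain i where "i \<le> n" "s i \<noteq> s' i"
      using PiE_ext[of s "{..n}" "\<lambda>_. G" s'] by auto
    then show "?E s \<inter> ?E s' = {}" by auto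
  qed
  moreover have "?E ` ?I \<subseteq> sets M" by auto
  ultimately show ?thesis
    by (simp add: finite_measure_finite_Union)
qed

lemma prob_state_decomposition:
  assumes [measurable]: "Measurable.pred M B"
  shows "prob {\<omega> \<in> space M. B \<omega>} = (\<Sum>d\<in>G. prob {\<omega> \<in> space M. Y m \<omega> = d \<and> B \<omega>})"
proof -
  have "{\<omega> \<in> space M. B \<omega>} = (\<Union>d\<in>G. {\<omega> \<in> space M. Y m \<omega> = d \<and> B \<omega>})"
    using Y_in by auto
  moreover have "disjoint_family_on (\<lambda>d. {\<omega> \<in> space M. Y m \<omega> = d \<and> B \<omega>}) G"
    by (auto simp: disjoint_family_on_def)
  moreover have "(\<lambda>d. {\<omega> \<in> space M. Y m \<omega> = d \<and> B \<omega>}) ` G \<subseteq> sets M" by auto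
  ultimately show ?thesis
    using finite_states by (simp add: finite_measure_finite_Union)
qed

text \<open>The inequalities in the joint law are strict, so thresholds 0 give the law of the jump
  chain only on the event of positive holding times. \<open>AE_holding_pos\<close> removes this
  restriction.\<close>

lemma prob_path_holding_pos:
  assumes "\<And>i. i \<le> n \<Longrightarrow> s i \<in> G"
  shows "prob {\<omega> \<in> space M. (\<forall>i\<le>n. Y i \<omega> = s i) \<and> (\<forall>i\<le>n. H i \<omega> > 0)} =
    prob {\<omega> \<in> space M. x 0 \<omega> = s 0} * (\<Prod>i<n. p (s i) (s (Suc i)))"
  using jump_chain_holding_times[of n s "\<lambda>_. 0"] assms
  by (simp add: all_conj_distrib imp_conjR cong: conj_cong)

text \<open>The joint law with thresholds 0, summed over all paths, gives 1, because the initial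
  distribution and the rows of \<open>jump_prob\<close> sum to 1. So no mass is left for a vanishing
  holding time, the value produced by \<open>jump_time\<close> for a path stuck in a state.\<close>

lemma AE_holding_pos: "AE \<omega> in M. \<forall>i. H i \<omega> > 0"
proof -
  have Y0: "Y 0 \<omega> = x 0 \<omega>" for \<omega> by (simp add: jump_state_def)
  have "prob {\<omega> \<in> space M. \<forall>i\<le>n. H i \<omega> > 0} = 1" for n
  proof (induction n)
    case 0
    have "prob {\<omega> \<in> space M. \<forall>i\<le>0. H i \<omega> > 0} =
        (\<Sum>d\<in>G. prob {\<omega> \<in> space M. Y 0 \<omega> = d \<and> (\<forall>i\<le>0. H i \<omega> > 0)})"
      by (rule prob_state_decomposition) measurable
    also have "\<dots> = (\<Sum>d\<in>G. prob {\<omega> \<in> space M. x 0 \<omega> = d})"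
      using prob_path_holding_pos[of 0 "\<lambda>_. _"] by (intro sum.cong) auto
    also have "\<dots> = prob {\<omega> \<in> space M. True}"
      by (subst prob_state_decomposition[of _ 0]) (simp_all add: Y0)
    finally show ?case using prob_space by simp
  next
    case (Suc n)
    let ?E = "\<lambda>n \<omega>. \<forall>i\<le>n. H i \<omega> > 0"
    \<comment> \<open>Requiring one more positive holding time costs no probability: the sum over
      the next state \<open>d\<close> has the factors \<open>p (s n) d\<close>, which add up to
      1.\<close>
    have step: "prob {\<omega> \<in> space M. (\<forall>i\<le>n. Y i \<omega> = s i) \<and> ?E (Suc n) \<omega>} =
        prob {\<omega> \<in> space M. (\<forall>i\<le>n. Y i \<omega> = s i) \<and> ?E n \<omega>}"
      if s: "s \<in> {..n} \<rightarrow>\<^sub>E G" for s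
    proof -
      have "prob {\<omega> \<in> space M. (\<forall>i\<le>n. Y i \<omega> = s i) \<and> ?E (Suc n) \<omega>} =
          (\<Sum>d\<in>G. prob {\<omega> \<in> space M. Y (Suc n) \<omega> = d \<and> (\<forall>i\<le>n. Y i \<omega> = s i) \<and> ?E (Suc n) \<omega>})"
        by (rule prob_state_decomposition) measurable
      also have "\<dots> = (\<Sum>d\<in>G. prob {\<omega> \<in> space M. (\<forall>i\<le>Suc n. Y i \<omega> = (s(Suc n := d)) i) \<and> ?E (Suc n) \<omega>})"
        by (intro sum.cong refl arg_cong[where f = prob] Collect_cong) (auto simp: le_Suc_eq)
      also have "\<dots> = (\<Sum>d\<in>G. prob {\<omega> \<in> space M. x 0 \<omega> = s 0} * (\<Prod>i<n. p (s i) (s (Suc i))) * p (s n) d)"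
      proof (intro sum.cong refl)
        fix d assume "d \<in> G"
        then have "(s(Suc n := d)) i \<in> G" if "i \<le> Suc n" for i
          using s that by (auto simp: le_Suc_eq)
        then show "prob {\<omega> \<in> space M. (\<forall>i\<le>Suc n. Y i \<omega> = (s(Suc n := d)) i) \<and> ?E (Suc n) \<omega>} =
            prob {\<omega> \<in> space M. x 0 \<omega> = s 0} * (\<Prod>i<n. p (s i) (s (Suc i))) * p (s n) d"
          by (subst prob_path_holding_pos) auto
      qed
      also have "\<dots> = prob {\<omega> \<in> space M. x 0 \<omega> = s 0} * (\<Prod>i<n. p (s i) (s (Suc i)))"
        using s sum_jump_prob[of "s n"] by (auto simp flip: sum_distrib_left)
      also have "\<dots> = prob {\<omega> \<in> space M. (\<forall>i\<le>n. Y i \<omega> = s i) \<and> ?E n \<omega>}"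
        using s by (subst prob_path_holding_pos) auto
      finally show ?thesis .
    qed
    have "prob {\<omega> \<in> space M. ?E (Suc n) \<omega>} = prob {\<omega> \<in> space M. ?E n \<omega>}"
      using prob_path_decomposition[where \<Phi> = "\<lambda>_. True" and n = n and B = "?E (Suc n)"]
        prob_path_decomposition[where \<Phi> = "\<lambda>_. True" and n = n and B = "?E n"] step
      by simp
    with Suc show ?case by simp
  qed
  then have "AE \<omega> in M. \<forall>i\<le>n. H i \<omega> > 0" for n
    by (subst (asm) prob_Collect_eq_1) auto
  then have "AE \<omega> in M. \<forall>n. \<forall>i\<le>n. H i \<omega> > 0"
    by (simp add: AE_all_countable)
  then show ?thesis by eventually_elim blast
qed

lemma prob_path:
  assumes "\<And>i. i \<le> n \<Longrightarrow> s i \<in> G"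
  shows "prob {\<omega> \<in> space M. \<forall>i\<le>n. Y i \<omega> = s i} =
    prob {\<omega> \<in> space M. x 0 \<omega> = s 0} * (\<Prod>i<n. p (s i) (s (Suc i)))"
proof -
  have "prob {\<omega> \<in> space M. \<forall>i\<le>n. Y i \<omega> = s i} =
      prob {\<omega> \<in> space M. (\<forall>i\<le>n. Y i \<omega> = s i) \<and> (\<forall>i\<le>n. H i \<omega> > 0)}"
    using AE_holding_pos by (intro prob_eq_AE) (auto elim: eventually_mono)
  then show ?thesis
    using prob_path_holding_pos[OF assms] by simp
qed

lemma prob_path_Suc:
  assumes "\<And>i. i \<le> n \<Longrightarrow> s i \<in> G" "d \<in> G"
  shows "prob {\<omega> \<in> space M. (\<forall>i\<le>n. Y i \<omega> = s i) \<and> Y (Suc n) \<omega> = d} =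
    p (s n) d * prob {\<omega> \<in> space M. \<forall>i\<le>n. Y i \<omega> = s i}"
proof -
  have "prob {\<omega> \<in> space M. (\<forall>i\<le>n. Y i \<omega> = s i) \<and> Y (Suc n) \<omega> = d} =
      prob {\<omega> \<in> space M. \<forall>i\<le>Suc n. Y i \<omega> = (s(Suc n := d)) i}"
    by (intro arg_cong[where f = prob] Collect_cong) (auto simp: le_Suc_eq)
  also have "\<dots> = prob {\<omega> \<in> space M. x 0 \<omega> = s 0} * (\<Prod>i<n. p (s i) (s (Suc i))) * p (s n) d"
    using assms by (subst prob_path) (auto simp: le_Suc_eq)
  finally show ?thesis
    using prob_path[OF assms(1)] by simp
qed

text \<open>For a single path this is the product formula, whose last factor depends only on the
  state at \<open>n\<close>. \<open>\<Phi>\<close> may be any event of the path up to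
  \<open>n\<close> that fixes this state.\<close>

lemma markov_property:
  assumes "d \<in> G" and \<Phi>: "\<And>s. \<Phi> s \<Longrightarrow> s n = c"
  shows "prob {\<omega> \<in> space M. \<Phi> (\<lambda>i\<in>{..n}. Y i \<omega>) \<and> Y (Suc n) \<omega> = d} =
    p c d * prob {\<omega> \<in> space M. \<Phi> (\<lambda>i\<in>{..n}. Y i \<omega>)}"
proof -
  let ?I = "{s. s \<in> {..n} \<rightarrow>\<^sub>E G \<and> \<Phi> s}"
  have "prob {\<omega> \<in> space M. \<Phi> (\<lambda>i\<in>{..n}. Y i \<omega>) \<and> Y (Suc n) \<omega> = d} =
      (\<Sum>s\<in>?I. prob {\<omega> \<in> space M. (\<forall>i\<le>n. Y i \<omega> = s i) \<and> Y (Suc n) \<omega> = d})"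
    by (rule prob_path_decomposition) measurable
  also have "\<dots> = (\<Sum>s\<in>?I. p c d * prob {\<omega> \<in> space M. (\<forall>i\<le>n. Y i \<omega> = s i) \<and> True})"
  proof (intro sum.cong refl)
    fix s assume s: "s \<in> ?I"
    then show "prob {\<omega> \<in> space M. (\<forall>i\<le>n. Y i \<omega> = s i) \<and> Y (Suc n) \<omega> = d} =
        p c d * prob {\<omega> \<in> space M. (\<forall>i\<le>n. Y i \<omega> = s i) \<and> True}"
      using \<Phi>[of s] assms(1) by (subst prob_path_Suc) auto
  qed
  also have "\<dots> = p c d * prob {\<omega> \<in> space M. \<Phi> (\<lambda>i\<in>{..n}. Y i \<omega>) \<and> True}"
    by (subst prob_path_decomposition) (simp_all add: sum_distrib_left)
  finally show ?thesis by simp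
qed

lemma prob_path_holding:
  assumes s: "\<And>i. i \<le> n \<Longrightarrow> s i \<in> G" and "J \<subseteq> {..n}" and U: "\<And>i. i \<in> J \<Longrightarrow> U i \<ge> 0"
  shows "prob {\<omega> \<in> space M. (\<forall>i\<le>n. Y i \<omega> = s i) \<and> (\<forall>i\<in>J. H i \<omega> > U i)} =
    prob {\<omega> \<in> space M. \<forall>i\<le>n. Y i \<omega> = s i} * (\<Prod>i\<in>J. exp (- q (s i) * U i))"
proof -
  \<comment> \<open>A threshold 0 is exceeded almost surely and contributes the factor
    \<open>exp 0 = 1\<close>; this passes from all indices up to \<open>n\<close> to the subset
    \<open>J\<close>.\<close>
  define V where "V = (\<lambda>i. if i \<in> J then U i else 0)"
  have [measurable]: "finite J" using assms(2) finite_subset by blast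
  have "prob {\<omega> \<in> space M. (\<forall>i\<le>n. Y i \<omega> = s i) \<and> (\<forall>i\<in>J. H i \<omega> > U i)} =
      prob {\<omega> \<in> space M. \<forall>i\<le>n. Y i \<omega> = s i \<and> H i \<omega> > V i}"
  proof (rule prob_eq_AE)
    show "AE \<omega> in M. ((\<forall>i\<le>n. Y i \<omega> = s i) \<and> (\<forall>i\<in>J. H i \<omega> > U i)) \<longleftrightarrow>
        (\<forall>i\<le>n. Y i \<omega> = s i \<and> H i \<omega> > V i)"
      using AE_holding_pos
      by eventually_elim (use assms(2) in \<open>auto simp: V_def subset_eq\<close>)
  qed measurable
  also have "\<dots> = prob {\<omega> \<in> space M. \<forall>i\<le>n. Y i \<omega> = s i} * (\<Prod>i\<le>n. exp (- q (s i) * V i))"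
    using s U by (subst jump_chain_holding_times) (auto simp: V_def prob_path)
  also have "(\<Prod>i\<le>n. exp (- q (s i) * V i)) = (\<Prod>i\<in>J. exp (- q (s i) * U i))"
    using assms(2) by (intro prod.mono_neutral_cong_right) (auto simp: V_def)
  finally show ?thesis .
qed

text \<open>Given that the states with index in \<open>J\<close> equal \<open>c\<close>, the holding
  times there are independent exponentials with the same rate, whatever the other states are. A
  smaller \<open>J'\<close> gives the tail of one holding time jointly with the state at another
  index.\<close>

lemma holding_tail:
  assumes "finite J" "J' \<subseteq> J" and U: "\<And>i. i \<in> J' \<Longrightarrow> U i \<ge> 0"
  shows "prob {\<omega> \<in> space M. (\<forall>i\<in>J. Y i \<omega> = c) \<and> (\<forall>i\<in>J'. H i \<omega> > U i)} =
    prob {\<omega> \<in> space M. \<forall>i\<in>J. Y i \<omega> = c} * (\<Prod>i\<in>J'. exp (- q c * U i))"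
proof -
  obtain n where n: "J \<subseteq> {..n}"
    using assms(1) finite_nat_iff_bounded_le by blast
  have [measurable]: "finite J'" using assms(1,2) finite_subset by blast
  let ?\<Phi> = "\<lambda>s. \<forall>i\<in>J. s i = c"
  let ?I = "{s. s \<in> {..n} \<rightarrow>\<^sub>E G \<and> ?\<Phi> s}"
  have eq: "?\<Phi> (\<lambda>i\<in>{..n}. Y i \<omega>) \<longleftrightarrow> (\<forall>i\<in>J. Y i \<omega> = c)" for \<omega>
    using n by auto
  have "prob {\<omega> \<in> space M. ?\<Phi> (\<lambda>i\<in>{..n}. Y i \<omega>) \<and> (\<forall>i\<in>J'. H i \<omega> > U i)} =
     (\<Sum>s\<in>?I. prob {\<omega> \<in> space M. (\<forall>i\<le>n. Y i \<omega> = s i) \<and> (\<forall>i\<in>J'. H i \<omega> > U i)})"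
    by (rule prob_path_decomposition) measurable
  also have "\<dots> = (\<Sum>s\<in>?I. prob {\<omega> \<in> space M. (\<forall>i\<le>n. Y i \<omega> = s i) \<and> True} * (\<Prod>i\<in>J'. exp (- q c * U i)))"
  proof (intro sum.cong refl)
    fix s assume s: "s \<in> ?I"
    have "prob {\<omega> \<in> space M. (\<forall>i\<le>n. Y i \<omega> = s i) \<and> (\<forall>i\<in>J'. H i \<omega> > U i)} =
       prob {\<omega> \<in> space M. \<forall>i\<le>n. Y i \<omega> = s i} * (\<Prod>i\<in>J'. exp (- q (s i) * U i))"
      using s assms n by (intro prob_path_holding) auto
    also have "(\<Prod>i\<in>J'. exp (- q (s i) * U i)) = (\<Prod>i\<in>J'. exp (- q c * U i))"
      using s assms(2) by (intro prod.cong) auto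
    finally show "prob {\<omega> \<in> space M. (\<forall>i\<le>n. Y i \<omega> = s i) \<and> (\<forall>i\<in>J'. H i \<omega> > U i)} =
        prob {\<omega> \<in> space M. (\<forall>i\<le>n. Y i \<omega> = s i) \<and> True} * (\<Prod>i\<in>J'. exp (- q c * U i))"
      by simp
  qed
  also have "\<dots> = prob {\<omega> \<in> space M. ?\<Phi> (\<lambda>i\<in>{..n}. Y i \<omega>) \<and> True} * (\<Prod>i\<in>J'. exp (- q c * U i))"
    by (subst prob_path_decomposition) (simp_all add: sum_distrib_right)
  finally show ?thesis unfolding eq by simp
qed

lemma AE_jump_prob_nonzero: "AE \<omega> in M. \<forall>n. p (Y n \<omega>) (Y (Suc n) \<omega>) \<noteq> 0"
proof -
  have *: "AE \<omega> in M. \<not> (Y n \<omega> = c \<and> Y (Suc n) \<omega> = d)" if "c \<in> G" "d \<in> G" "p c d = 0" for n c d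
  proof -
    have "prob {\<omega> \<in> space M. Y n \<omega> = c \<and> Y (Suc n) \<omega> = d} = 0"
      using markov_property[of d "\<lambda>s. s n = c" n c] that by simp
    then show ?thesis
      by (subst (asm) prob_Collect_eq_0) auto
  qed
  have "AE \<omega> in M. \<forall>c\<in>G. \<forall>d\<in>G. p c d = 0 \<longrightarrow> \<not> (Y n \<omega> = c \<and> Y (Suc n) \<omega> = d)" for n
    using * finite_states by (intro AE_finite_allI) auto
  then have "AE \<omega> in M. \<forall>n. \<forall>c\<in>G. \<forall>d\<in>G. p c d = 0 \<longrightarrow> \<not> (Y n \<omega> = c \<and> Y (Suc n) \<omega> = d)"
    by (simp add: AE_all_countable)
  then show ?thesis
    using AE_space by eventually_elim (use Y_in in blast)
qed

section \<open>Averages of transition counts and holding times\<close>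

lemma has_bochner_integral_of_bool:
  assumes [measurable]: "Measurable.pred M P"
  shows "has_bochner_integral M (\<lambda>\<omega>. of_bool (P \<omega>) :: real) (prob {\<omega> \<in> space M. P \<omega>})"
proof -
  have "has_bochner_integral M (indicator {\<omega> \<in> space M. P \<omega>} :: _ \<Rightarrow> real) (prob {\<omega> \<in> space M. P \<omega>})"
    by (rule has_bochner_integral_real_indicator) (auto simp: less_top[symmetric])
  then show ?thesis
    by (rule has_bochner_integral_cong[THEN iffD1, rotated 3]) (auto simp: indicator_def)
qed

text \<open>These are martingale differences: from \<open>c\<close> the chain moves to
  \<open>d\<close> with probability \<open>p c d\<close> whatever its past, so the
  \<open>j\<close>-th difference is orthogonal to everything determined by the states up to
  \<open>j\<close>.\<close>

lemma transition_frequency: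
  assumes c: "c \<in> G" and d: "d \<in> G"
  shows "AE \<omega> in M. (\<lambda>m. (\<Sum>i<m. of_bool (Y i \<omega> = c \<and> Y (Suc i) \<omega> = d) - of_bool (Y i \<omega> = c) * p c d) / real m) \<longlonglongrightarrow> 0"
proof (rule strong_law_uncorrelated[where B = "p c d" and C = "(1 + p c d)\<^sup>2"])
  let ?a = "\<lambda>i \<omega>. of_bool (Y i \<omega> = c \<and> Y (Suc i) \<omega> = d) :: real"
  let ?b = "\<lambda>i \<omega>. of_bool (Y i \<omega> = c) * p c d"
  let ?D = "\<lambda>i \<omega>. ?a i \<omega> - ?b i \<omega>"
  note pc = jump_prob_nonneg[OF c d]
  show int: "integrable M (\<lambda>\<omega>. ?D i \<omega> * ?D j \<omega>)" for i j
  proof (rule integrable_const_bound[where B = "(1 + p c d) * (1 + p c d)"])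
    have D: "\<bar>?D i \<omega>\<bar> \<le> 1 + p c d" for i \<omega> using pc by auto
    have "\<bar>?D i \<omega>\<bar> * \<bar>?D j \<omega>\<bar> \<le> (1 + p c d) * (1 + p c d)" for \<omega>
      using pc by (intro mult_mono D) auto
    then show "AE \<omega> in M. norm (?D i \<omega> * ?D j \<omega>) \<le> (1 + p c d) * (1 + p c d)"
      unfolding real_norm_def abs_mult by (intro always_eventually allI)
  qed measurable
  show "expectation (\<lambda>\<omega>. ?D i \<omega> * ?D i \<omega>) \<le> (1 + p c d)\<^sup>2" for i
  proof -
    have "?D i \<omega> * ?D i \<omega> \<le> (1 + p c d)\<^sup>2" for \<omega>
      using pc by (auto simp: power2_eq_square algebra_simps)
    then have "expectation (\<lambda>\<omega>. ?D i \<omega> * ?D i \<omega>) \<le> expectation (\<lambda>\<omega>. (1 + p c d)\<^sup>2)"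
      by (intro integral_mono int) auto
    then show ?thesis using prob_space by simp
  qed
  show "expectation (\<lambda>\<omega>. ?D i \<omega> * ?D j \<omega>) = 0" if "i < j" for i j
  proof -
    \<comment> \<open>Since \<open>Suc i \<le> j\<close>, both events belong to the path up to
      \<open>j\<close>, also when \<open>Suc i = j\<close>. The four indicators in the expanded
      product then cancel in pairs by \<open>m1\<close> and \<open>m2\<close>.\<close>
    let ?e = "\<lambda>\<omega>. Y i \<omega> = c \<and> Y (Suc i) \<omega> = d" and ?e' = "\<lambda>\<omega>. Y i \<omega> = c"
    have m1: "prob {\<omega> \<in> space M. ?e \<omega> \<and> Y j \<omega> = c \<and> Y (Suc j) \<omega> = d} =
        p c d * prob {\<omega> \<in> space M. ?e \<omega> \<and> Y j \<omega> = c}"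
      using markov_property[of d "\<lambda>s. (s i = c \<and> s (Suc i) = d) \<and> s j = c" j c] that d by simp
    have m2: "prob {\<omega> \<in> space M. ?e' \<omega> \<and> Y j \<omega> = c \<and> Y (Suc j) \<omega> = d} =
        p c d * prob {\<omega> \<in> space M. ?e' \<omega> \<and> Y j \<omega> = c}"
      using markov_property[of d "\<lambda>s. s i = c \<and> s j = c" j c] that d by simp
    have "has_bochner_integral M (\<lambda>\<omega>.
          of_bool (?e \<omega> \<and> Y j \<omega> = c \<and> Y (Suc j) \<omega> = d) - p c d * of_bool (?e \<omega> \<and> Y j \<omega> = c)
        - p c d * (of_bool (?e' \<omega> \<and> Y j \<omega> = c \<and> Y (Suc j) \<omega> = d) - p c d * of_bool (?e' \<omega> \<and> Y j \<omega> = c)))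
        (prob {\<omega> \<in> space M. ?e \<omega> \<and> Y j \<omega> = c \<and> Y (Suc j) \<omega> = d} - p c d * prob {\<omega> \<in> space M. ?e \<omega> \<and> Y j \<omega> = c}
        - p c d * (prob {\<omega> \<in> space M. ?e' \<omega> \<and> Y j \<omega> = c \<and> Y (Suc j) \<omega> = d} - p c d * prob {\<omega> \<in> space M. ?e' \<omega> \<and> Y j \<omega> = c}))"
      by (intro has_bochner_integral_diff has_bochner_integral_mult_right has_bochner_integral_of_bool) measurable
    also have "(\<lambda>\<omega>. of_bool (?e \<omega> \<and> Y j \<omega> = c \<and> Y (Suc j) \<omega> = d) - p c d * of_bool (?e \<omega> \<and> Y j \<omega> = c)
        - p c d * (of_bool (?e' \<omega> \<and> Y j \<omega> = c \<and> Y (Suc j) \<omega> = d) - p c d * of_bool (?e' \<omega> \<and> Y j \<omega> = c)))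
        = (\<lambda>\<omega>. ?D i \<omega> * ?D j \<omega>)"
      by (auto simp: fun_eq_iff algebra_simps)
    finally show ?thesis
      unfolding m1 m2 by (auto dest: has_bochner_integral_integral_eq)
  qed
qed (use jump_prob_nonneg[OF c d] in \<open>auto\<close>)

text \<open>Given the states, distinct holding times are independent and those in \<open>c\<close>
  have mean \<open>1 / q c\<close>. For \<open>i \<noteq> j\<close> the four terms of the expanded
  product therefore have the same expectation up to the signs \<open>+ - - +\<close>.\<close>

lemma holding_average:
  assumes c: "c \<in> G"
  shows "AE \<omega> in M. (\<lambda>m. (\<Sum>i<m. of_bool (Y i \<omega> = c) * H i \<omega> - of_bool (Y i \<omega> = c) / q c) / real m) \<longlonglongrightarrow> 0"
proof (rule strong_law_uncorrelated[where B = "1 / q c" and C = "4 / (q c)\<^sup>2"])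
  let ?y = "\<lambda>i \<omega>. of_bool (Y i \<omega> = c) :: real"
  let ?a = "\<lambda>i \<omega>. ?y i \<omega> * H i \<omega>"
  let ?D = "\<lambda>i \<omega>. ?a i \<omega> - ?y i \<omega> / q c"
  define \<pi> where "\<pi> = (\<lambda>i j. prob {\<omega> \<in> space M. \<forall>l\<in>{i, j}. Y l \<omega> = c})"
  note qc = exit_rate_pos[OF c]
  have a0: "?a i \<omega> \<ge> 0" for i \<omega> by (simp add: holding_time_nonneg)
  have gt: "?a i \<omega> > u \<longleftrightarrow> Y i \<omega> = c \<and> H i \<omega> > u" if "u \<ge> 0" for i \<omega> u
    using that by auto
  have yy: "has_bochner_integral M (\<lambda>\<omega>. ?y i \<omega> * ?y j \<omega>) (\<pi> i j)" for i j
    using has_bochner_integral_of_bool[of "\<lambda>\<omega>. \<forall>l\<in>{i, j}. Y l \<omega> = c"]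
    by (simp add: \<pi>_def of_bool_conj)
  have ay: "has_bochner_integral M (\<lambda>\<omega>. ?a i \<omega> * ?y j \<omega>) (\<pi> i j / q c)" for i j
  proof (rule has_bochner_integral_nn_integral)
    have "(\<integral>\<^sup>+\<omega>. ennreal (?a i \<omega> * ?y j \<omega>) \<partial>M) =
        (\<integral>\<^sup>+u. \<integral>\<^sup>+v. ennreal (prob {\<omega> \<in> space M. ?a i \<omega> > u \<and> ?y j \<omega> > v})
           * indicator {0..} u * indicator {0..} v \<partial>lborel \<partial>lborel)"
      by (intro nn_integral_layer_cake2 a0) auto
    \<comment> \<open>\<open>?y j\<close> takes only the values 0 and 1, so its tail in
      \<open>v\<close> is constant on \<open>[0, 1)\<close> and vanishes beyond.\<close>
    also have "\<dots> = (\<integral>\<^sup>+u. \<integral>\<^sup>+v. (ennreal (\<pi> i j) * (ennreal (exp (- q c * u)) * indicator {0..} u)) * indicator {0..<1::real} v \<partial>lborel \<partial>lborel)"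
    proof (intro nn_integral_cong)
      fix u v :: real
      have "prob {\<omega> \<in> space M. ?a i \<omega> > u \<and> ?y j \<omega> > v} = \<pi> i j * exp (- q c * u)"
        if "u \<ge> 0" "v \<ge> 0" "v < 1"
      proof -
        have "prob {\<omega> \<in> space M. ?a i \<omega> > u \<and> ?y j \<omega> > v} =
            prob {\<omega> \<in> space M. (\<forall>l\<in>{i, j}. Y l \<omega> = c) \<and> (\<forall>l\<in>{i}. H l \<omega> > u)}"
          using that by (intro arg_cong[where f = prob] Collect_cong) (auto simp: gt)
        then show ?thesis
          using that by (subst (asm) holding_tail) (auto simp: \<pi>_def)
      qed
      moreover have "{\<omega> \<in> space M. ?a i \<omega> > u \<and> ?y j \<omega> > v} = {}" if "v \<ge> 1"
        using that by auto
      ultimately show "ennreal (prob {\<omega> \<in> space M. ?a i \<omega> > u \<and> ?y j \<omega> > v})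
           * indicator {0..} u * indicator {0..} v =
           (ennreal (\<pi> i j) * (ennreal (exp (- q c * u)) * indicator {0..} u)) * indicator {0..<1} v"
        by (cases "v \<ge> 1") (auto simp: indicator_def ennreal_mult \<pi>_def)
    qed
    also have "\<dots> = ennreal (\<pi> i j) * ennreal (1 / q c)"
      by (simp add: nn_integral_cmult nn_integral_exp_tail[OF qc, simplified] del: mult_minus_left)
    finally show "(\<integral>\<^sup>+\<omega>. ennreal (?a i \<omega> * ?y j \<omega>) \<partial>M) = ennreal (\<pi> i j / q c)"
      using qc by (simp add: \<pi>_def flip: ennreal_mult)
  qed (use qc in \<open>auto simp: \<pi>_def holding_time_nonneg\<close>)
  have aa: "has_bochner_integral M (\<lambda>\<omega>. ?a i \<omega> * ?a j \<omega>) (\<pi> i j / (q c)\<^sup>2)" if "i \<noteq> j" for i j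
  proof (rule has_bochner_integral_nn_integral)
    have "(\<integral>\<^sup>+\<omega>. ennreal (?a i \<omega> * ?a j \<omega>) \<partial>M) =
        (\<integral>\<^sup>+u. \<integral>\<^sup>+v. ennreal (prob {\<omega> \<in> space M. ?a i \<omega> > u \<and> ?a j \<omega> > v})
           * indicator {0..} u * indicator {0..} v \<partial>lborel \<partial>lborel)"
      by (intro nn_integral_layer_cake2 a0) auto
    also have "\<dots> = (\<integral>\<^sup>+u. \<integral>\<^sup>+v. (ennreal (\<pi> i j) * (ennreal (exp (- q c * u)) * indicator {0..} u)) *
          (ennreal (exp (- q c * v)) * indicator {0..} v) \<partial>lborel \<partial>lborel)"
    proof (intro nn_integral_cong)
      fix u v :: real
      have "prob {\<omega> \<in> space M. ?a i \<omega> > u \<and> ?a j \<omega> > v} = \<pi> i j * exp (- q c * u) * exp (- q c * v)"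
        if "u \<ge> 0" "v \<ge> 0"
      proof -
        have "prob {\<omega> \<in> space M. ?a i \<omega> > u \<and> ?a j \<omega> > v} =
            prob {\<omega> \<in> space M. (\<forall>l\<in>{i, j}. Y l \<omega> = c) \<and> (\<forall>l\<in>{i, j}. H l \<omega> > (if l = i then u else v))}"
          using that \<open>i \<noteq> j\<close> by (intro arg_cong[where f = prob] Collect_cong) (auto simp: gt)
        then show ?thesis
          using that \<open>i \<noteq> j\<close> by (subst (asm) holding_tail) (auto simp: \<pi>_def)
      qed
      then show "ennreal (prob {\<omega> \<in> space M. ?a i \<omega> > u \<and> ?a j \<omega> > v})
           * indicator {0..} u * indicator {0..} v =
           (ennreal (\<pi> i j) * (ennreal (exp (- q c * u)) * indicator {0..} u)) *
          (ennreal (exp (- q c * v)) * indicator {0..} v)"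
        by (auto simp: indicator_def ennreal_mult \<pi>_def)
    qed
    also have "\<dots> = ennreal (\<pi> i j) * ennreal (1 / q c) * ennreal (1 / q c)"
      by (simp add: nn_integral_cmult nn_integral_multc nn_integral_exp_tail[OF qc, simplified] del: mult_minus_left)
    finally show "(\<integral>\<^sup>+\<omega>. ennreal (?a i \<omega> * ?a j \<omega>) \<partial>M) = ennreal (\<pi> i j / (q c)\<^sup>2)"
      using qc by (simp add: \<pi>_def power2_eq_square flip: ennreal_mult)
  qed (use qc in \<open>auto simp: \<pi>_def holding_time_nonneg\<close>)
  \<comment> \<open>Both thresholds concern the same holding time, so the tail is at most
    \<open>exp (- q c * max u v)\<close>. Bounding \<open>max u v\<close> below by
    \<open>(u + v) / 2\<close> makes this a product of two tails of rate \<open>q c / 2\<close>,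
    each with integral \<open>2 / q c\<close>; hence the constant 4.\<close>
  have asq_le: "(\<integral>\<^sup>+\<omega>. ennreal (?a i \<omega> * ?a i \<omega>) \<partial>M) \<le> ennreal (4 / (q c)\<^sup>2)" for i
  proof -
    have q2: "q c / 2 > 0" using qc by simp
    have "(\<integral>\<^sup>+\<omega>. ennreal (?a i \<omega> * ?a i \<omega>) \<partial>M) =
        (\<integral>\<^sup>+u. \<integral>\<^sup>+v. ennreal (prob {\<omega> \<in> space M. ?a i \<omega> > u \<and> ?a i \<omega> > v})
           * indicator {0..} u * indicator {0..} v \<partial>lborel \<partial>lborel)"
      by (intro nn_integral_layer_cake2 a0) auto
    also have "\<dots> \<le> (\<integral>\<^sup>+u. \<integral>\<^sup>+v. (ennreal (exp (- (q c / 2) * u)) * indicator {0..} u) *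
          (ennreal (exp (- (q c / 2) * v)) * indicator {0..} v) \<partial>lborel \<partial>lborel)"
    proof (intro nn_integral_mono)
      fix u v :: real
      have "prob {\<omega> \<in> space M. ?a i \<omega> > u \<and> ?a i \<omega> > v} \<le> exp (- (q c / 2) * u) * exp (- (q c / 2) * v)"
        if uv: "u \<ge> 0" "v \<ge> 0"
      proof -
        have "prob {\<omega> \<in> space M. ?a i \<omega> > u \<and> ?a i \<omega> > v} =
            prob {\<omega> \<in> space M. (\<forall>l\<in>{i}. Y l \<omega> = c) \<and> (\<forall>l\<in>{i}. H l \<omega> > max u v)}"
          using uv by (intro arg_cong[where f = prob] Collect_cong) (auto simp: gt)
        also have "\<dots> \<le> exp (- q c * max u v)"
          using uv by (subst holding_tail) (auto simp: mult_left_le_one_le)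
        also have "\<dots> \<le> exp (- q c * ((u + v) / 2))"
          using qc by auto
        also have "\<dots> = exp (- (q c / 2) * u) * exp (- (q c / 2) * v)"
          by (simp add: exp_add[symmetric] field_simps)
        finally show ?thesis .
      qed
      then show "ennreal (prob {\<omega> \<in> space M. ?a i \<omega> > u \<and> ?a i \<omega> > v})
           * indicator {0..} u * indicator {0..} v \<le>
           (ennreal (exp (- (q c / 2) * u)) * indicator {0..} u) *
          (ennreal (exp (- (q c / 2) * v)) * indicator {0..} v)"
        by (auto simp: indicator_def simp flip: ennreal_mult)
    qed
    also have "\<dots> = ennreal (1 / (q c / 2)) * ennreal (1 / (q c / 2))"
      using nn_integral_exp_tail[OF q2] by (simp add: nn_integral_cmult nn_integral_multc)
    also have "\<dots> = ennreal (4 / (q c)\<^sup>2)"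
      using qc by (simp add: power2_eq_square flip: ennreal_mult)
    finally show ?thesis .
  qed
  have int_asq: "integrable M (\<lambda>\<omega>. ?a i \<omega> * ?a i \<omega>)" for i
    using asq_le[of i] by (intro integrableI_nonneg) (auto simp: le_less_trans)
  have E_asq: "expectation (\<lambda>\<omega>. ?a i \<omega> * ?a i \<omega>) \<le> 4 / (q c)\<^sup>2" for i
  proof -
    have "ennreal (expectation (\<lambda>\<omega>. ?a i \<omega> * ?a i \<omega>)) \<le> ennreal (4 / (q c)\<^sup>2)"
      using asq_le[of i] nn_integral_eq_integral[OF int_asq[of i]] by simp
    then show ?thesis by simp
  qed
  have DD: "?D i \<omega> * ?D j \<omega> = ?a i \<omega> * ?a j \<omega> - (?a i \<omega> * ?y j \<omega>) / q c - (?a j \<omega> * ?y i \<omega>) / q c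
      + (?y i \<omega> * ?y j \<omega>) / (q c)\<^sup>2" for i j \<omega>
    using qc by (simp add: field_simps power2_eq_square)
  have \<pi>_sym: "\<pi> i j = \<pi> j i" for i j
    unfolding \<pi>_def by (simp add: insert_commute)
  have E: "has_bochner_integral M (\<lambda>\<omega>. ?D i \<omega> * ?D j \<omega>)
      (e - (\<pi> i j / q c) / q c - (\<pi> j i / q c) / q c + \<pi> i j / (q c)\<^sup>2)"
    if "has_bochner_integral M (\<lambda>\<omega>. ?a i \<omega> * ?a j \<omega>) e" for i j e
    unfolding DD
    by (intro has_bochner_integral_add has_bochner_integral_diff has_bochner_integral_divide_zero that ay yy)
  have Esq: "has_bochner_integral M (\<lambda>\<omega>. ?a i \<omega> * ?a i \<omega>) (expectation (\<lambda>\<omega>. ?a i \<omega> * ?a i \<omega>))" for i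
    by (rule has_bochner_integral_integrable[OF int_asq])
  show "integrable M (\<lambda>\<omega>. ?D i \<omega> * ?D j \<omega>)" for i j
    using E[OF aa, of i j] E[OF Esq, of i] integrable.intros by (cases "i = j") blast+
  show "expectation (\<lambda>\<omega>. ?D i \<omega> * ?D j \<omega>) = 0" if "i < j" for i j
    using has_bochner_integral_integral_eq[OF E[OF aa, of i j]] that
    by (simp add: \<pi>_sym[of j i] power2_eq_square)
  show "expectation (\<lambda>\<omega>. ?D i \<omega> * ?D i \<omega>) \<le> 4 / (q c)\<^sup>2" for i
  proof -
    have "expectation (\<lambda>\<omega>. ?D i \<omega> * ?D i \<omega>) = expectation (\<lambda>\<omega>. ?a i \<omega> * ?a i \<omega>) - \<pi> i i / (q c)\<^sup>2"
      using has_bochner_integral_integral_eq[OF E[OF Esq, of i]] by (simp add: power2_eq_square)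
    moreover have "\<pi> i i / (q c)\<^sup>2 \<ge> 0" by (simp add: \<pi>_def)
    ultimately show ?thesis using E_asq[of i] by linarith
  qed
qed (use exit_rate_pos[OF c] in \<open>auto simp: holding_time_nonneg\<close>)

end

section \<open>Reversible chains\<close>

locale reversible_ctmc = nonabsorbing_ctmc +
  fixes w :: "'b \<Rightarrow> real"
  assumes no_self_rate: "\<And>c. c \<in> G \<Longrightarrow> Q c c = 0"
    and weight_pos: "\<And>c. c \<in> G \<Longrightarrow> w c > 0"
    and detailed_balance: "\<And>c d. c \<in> G \<Longrightarrow> d \<in> G \<Longrightarrow> w c * Q c d = w d * Q d c"
    and irreducible: "\<And>c d. c \<in> G \<Longrightarrow> d \<in> G \<Longrightarrow> (c, d) \<in> {(c, d). c \<in> G \<and> d \<in> G \<and> Q c d > 0}\<^sup>*"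
begin

declare sum_of_bool_eq [simp del] sum_mult_of_bool_eq [simp del] sum_of_bool_mult_eq [simp del]

text \<open>Normalises the weights \<open>w c * q c\<close>, which are stationary for the jump
  chain. \<open>\<kappa> * w c\<close> is then the mean time spent in \<open>c\<close> per
  transition, as \<open>ergodic_occupation\<close> shows.\<close>

definition \<kappa> :: real where "\<kappa> = 1 / (\<Sum>c\<in>G. w c * q c)"

lemma rate_eq_jump_prob: "c \<in> G \<Longrightarrow> d \<in> G \<Longrightarrow> Q c d = q c * p c d"
  using exit_rate_pos[of c] no_self_rate[of c] by (auto simp: jump_prob_def)

lemma exit_rate_eq_sum: "c \<in> G \<Longrightarrow> q c = (\<Sum>d\<in>G. Q c d)"
  unfolding exit_rate_def using finite_states no_self_rate[of c] by (simp add: sum_diff1)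

lemma states_nonempty: "G \<noteq> {}"
  using Y_in not_empty by blast

lemma \<kappa>_pos: "\<kappa> > 0"
  unfolding \<kappa>_def using finite_states states_nonempty weight_pos exit_rate_pos
  by (intro divide_pos_pos sum_pos) auto

text \<open>By detailed balance \<open>w d * Q d c\<close> is symmetric, so each square splits into
  one term for either endpoint, and exchanging the sums makes the two totals equal. The inner sum on
  the right is the net flow out of \<open>d\<close>: for bounded \<open>r\<close>, small flows make
  the form small.\<close>

lemma dirichlet_form:
  "(\<Sum>d\<in>G. \<Sum>c\<in>G. w d * Q d c * (r d - r c)\<^sup>2) = 2 * (\<Sum>d\<in>G. r d * (\<Sum>c\<in>G. w d * Q d c * (r d - r c)))"
proof -
  let ?T = "\<lambda>d c. w d * Q d c * (r d - r c) * r d"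
  have "(\<Sum>d\<in>G. \<Sum>c\<in>G. w d * Q d c * (r d - r c)\<^sup>2) = (\<Sum>d\<in>G. \<Sum>c\<in>G. ?T d c + ?T c d)"
  proof (intro sum.cong refl)
    fix d c assume "d \<in> G" "c \<in> G"
    then show "w d * Q d c * (r d - r c)\<^sup>2 = ?T d c + ?T c d"
      using detailed_balance[of c d] by (simp add: algebra_simps power2_eq_square)
  qed
  also have "\<dots> = (\<Sum>d\<in>G. \<Sum>c\<in>G. ?T d c) + (\<Sum>d\<in>G. \<Sum>c\<in>G. ?T c d)"
    by (simp add: sum.distrib)
  also have "(\<Sum>d\<in>G. \<Sum>c\<in>G. ?T c d) = (\<Sum>d\<in>G. \<Sum>c\<in>G. ?T d c)"
    by (rule sum.swap)
  finally show ?thesis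
    by (simp add: sum_distrib_left mult_ac)
qed

text \<open>Up to the first and the last state, visits to \<open>d\<close> are transitions into
  \<open>d\<close>, which split according to their origin. \<open>y\<close> is a fixed sequence:
  from here on the argument is pathwise.\<close>

lemma visit_balance:
  fixes y :: "nat \<Rightarrow> 'b"
  assumes y: "\<And>i. y i \<in> G" and d: "d \<in> G"
    and trans: "\<And>c. c \<in> G \<Longrightarrow>
      (\<lambda>m. (\<Sum>i<m. of_bool (y i = c \<and> y (Suc i) = d) - of_bool (y i = c) * p c d) / real m) \<longlonglongrightarrow> 0"
  shows "(\<lambda>m. ((\<Sum>i<m. of_bool (y i = d)) - (\<Sum>c\<in>G. (\<Sum>i<m. of_bool (y i = c)) * p c d)) / real m) \<longlonglongrightarrow> 0"
proof -
  define V where "V = (\<lambda>m c. \<Sum>i<m. of_bool (y i = c) :: real)"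
  let ?f = "\<lambda>m c. \<Sum>i<m. of_bool (y i = c \<and> y (Suc i) = d) - of_bool (y i = c) * p c d :: real"
  have eq: "(V m d - (\<Sum>c\<in>G. V m c * p c d)) / real m =
      (\<Sum>c\<in>G. ?f m c / real m) + (of_bool (y 0 = d) - of_bool (y m = d)) / real m" for m
  proof -
    have "(\<Sum>c\<in>G. ?f m c) = (\<Sum>c\<in>G. \<Sum>i<m. of_bool (y i = c \<and> y (Suc i) = d)) - (\<Sum>c\<in>G. V m c * p c d)"
      by (simp only: V_def sum_subtractf sum_distrib_right)
    also have "(\<Sum>c\<in>G. \<Sum>i<m. of_bool (y i = c \<and> y (Suc i) = d)) =
        (\<Sum>i<m. \<Sum>c\<in>G. of_bool (y i = c \<and> y (Suc i) = d) :: real)"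
      by (rule sum.swap)
    also have "\<dots> = (\<Sum>i<m. of_bool (y (Suc i) = d))"
    proof (intro sum.cong refl)
      fix i
      have "(\<Sum>c\<in>G. of_bool (y i = c \<and> y (Suc i) = d) :: real) = (\<Sum>c\<in>G. if y i = c then of_bool (y (Suc i) = d) else 0)"
        by (intro sum.cong) auto
      then show "(\<Sum>c\<in>G. of_bool (y i = c \<and> y (Suc i) = d) :: real) = of_bool (y (Suc i) = d)"
        using finite_states y by simp
    qed
    also have "\<dots> = V m d - of_bool (y 0 = d) + of_bool (y m = d)"
      unfolding V_def by (induction m) auto
    finally have "V m d - (\<Sum>c\<in>G. V m c * p c d) = (\<Sum>c\<in>G. ?f m c) + (of_bool (y 0 = d) - of_bool (y m = d))"
      by simp
    then show ?thesis by (simp add: add_divide_distrib sum_divide_distrib)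
  qed
  have "(\<lambda>m. (of_bool (y 0 = d) - of_bool (y m = d)) / real m) \<longlonglongrightarrow> 0"
  proof (rule Lim_null_comparison)
    show "\<forall>\<^sub>F m in sequentially. norm ((of_bool (y 0 = d) - of_bool (y m = d)) / real m) \<le> 1 / real m"
      by (intro always_eventually allI) auto
  qed (rule lim_const_over_n)
  then have "(\<lambda>m. (\<Sum>c\<in>G. ?f m c / real m) + (of_bool (y 0 = d) - of_bool (y m = d)) / real m) \<longlonglongrightarrow> (\<Sum>c\<in>G. 0) + 0"
    by (intro tendsto_add tendsto_sum trans) auto
  then show ?thesis
    using eq unfolding V_def by simp
qed

lemma visit_frequency:
  fixes y :: "nat \<Rightarrow> 'b"
  assumes y: "\<And>i. y i \<in> G" and a: "a \<in> G"
    and trans: "\<And>c d. c \<in> G \<Longrightarrow> d \<in> G \<Longrightarrow>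
      (\<lambda>m. (\<Sum>i<m. of_bool (y i = c \<and> y (Suc i) = d) - of_bool (y i = c) * p c d) / real m) \<longlonglongrightarrow> 0"
  shows "(\<lambda>m. (\<Sum>i<m. of_bool (y i = a)) / real m) \<longlonglongrightarrow> \<kappa> * w a * q a"
proof -
  define V where "V = (\<lambda>m c. \<Sum>i<m. of_bool (y i = c) :: real)"
  define r where "r = (\<lambda>m c. V m c / real m / (w c * q c))"
  define F where "F = (\<lambda>m. \<Sum>d\<in>G. \<Sum>c\<in>G. w d * Q d c * (r m d - r m c)\<^sup>2)"
  have wq: "w c * q c > 0" if "c \<in> G" for c
    using that weight_pos exit_rate_pos by simp
  have Vr: "V m c / real m = w c * q c * r m c" if "c \<in> G" for m c
    using weight_pos[OF that] exit_rate_pos[OF that] by (simp add: r_def)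
  have V_bounds: "0 \<le> V m c" "V m c \<le> real m" for m c
  proof -
    show "0 \<le> V m c" by (simp add: V_def sum_nonneg)
    have "V m c \<le> (\<Sum>i<m. 1)" unfolding V_def by (intro sum_mono) auto
    then show "V m c \<le> real m" by simp
  qed
  have r_bound: "\<bar>r m c\<bar> \<le> 1 / (w c * q c)" if "c \<in> G" for m c
    using wq[OF that] V_bounds[of m c] by (auto simp: r_def abs_divide divide_simps)
  \<comment> \<open>The flow of \<open>r\<close> out of \<open>d\<close> is exactly the imbalance of
    \<open>visit_balance\<close>, since detailed balance turns \<open>w d * Q d c\<close> into
    \<open>w c * q c * p c d\<close>.\<close>
  have flow: "(\<lambda>m. \<Sum>c\<in>G. w d * Q d c * (r m d - r m c)) \<longlonglongrightarrow> 0" if d: "d \<in> G" for d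
  proof -
    have "(\<Sum>c\<in>G. w d * Q d c * (r m d - r m c)) = (V m d - (\<Sum>c\<in>G. V m c * p c d)) / real m" for m
    proof -
      have "(\<Sum>c\<in>G. w d * Q d c * (r m d - r m c)) = w d * q d * r m d - (\<Sum>c\<in>G. w d * Q d c * r m c)"
        by (simp add: right_diff_distrib sum_subtractf exit_rate_eq_sum[OF d] sum_distrib_left sum_distrib_right)
      also have "(\<Sum>c\<in>G. w d * Q d c * r m c) = (\<Sum>c\<in>G. V m c / real m * p c d)"
      proof (intro sum.cong refl)
        fix c assume c: "c \<in> G"
        have "w d * Q d c = w c * q c * p c d"
          using detailed_balance[OF c d] rate_eq_jump_prob[OF c d] by simp
        then show "w d * Q d c * r m c = V m c / real m * p c d"
          unfolding Vr[OF c] by simp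
      qed
      finally show ?thesis
        unfolding Vr[OF d, symmetric] by (simp add: diff_divide_distrib sum_divide_distrib)
    qed
    then show ?thesis
      using visit_balance[OF y d trans[OF _ d]] unfolding V_def by simp
  qed
  have "(\<lambda>m. r m d * (\<Sum>c\<in>G. w d * Q d c * (r m d - r m c))) \<longlonglongrightarrow> 0" if d: "d \<in> G" for d
  proof (rule Lim_null_comparison)
    show "\<forall>\<^sub>F m in sequentially. norm (r m d * (\<Sum>c\<in>G. w d * Q d c * (r m d - r m c)))
        \<le> 1 / (w d * q d) * \<bar>\<Sum>c\<in>G. w d * Q d c * (r m d - r m c)\<bar>"
      using r_bound[OF d] by (intro always_eventually allI) (simp only: real_norm_def abs_mult mult_right_mono abs_ge_zero)
    show "(\<lambda>m. 1 / (w d * q d) * \<bar>\<Sum>c\<in>G. w d * Q d c * (r m d - r m c)\<bar>) \<longlonglongrightarrow> 0"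
      using tendsto_rabs_zero[OF flow[OF d]] by (intro tendsto_mult_right_zero)
  qed
  then have "(\<lambda>m. 2 * (\<Sum>d\<in>G. r m d * (\<Sum>c\<in>G. w d * Q d c * (r m d - r m c)))) \<longlonglongrightarrow> 2 * (\<Sum>d\<in>G. 0)"
    by (intro tendsto_intros)
  then have F0: "F \<longlonglongrightarrow> 0"
    unfolding F_def dirichlet_form by simp
  \<comment> \<open>The terms of the Dirichlet form are nonnegative, so each of them tends to 0, and
    a positive rate forces the values at the two ends of the edge together.\<close>
  have edge: "(\<lambda>m. r m d - r m c) \<longlonglongrightarrow> 0" if dc: "d \<in> G" "c \<in> G" "Q d c > 0" for c d
  proof -
    have wQ: "w d * Q d c > 0" using dc weight_pos by simp
    have nn: "0 \<le> w d' * Q d' c' * (r m d' - r m c')\<^sup>2" if "d' \<in> G" "c' \<in> G" for d' c' m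
      using that weight_pos[of d'] rate_nonneg[of d' c'] by simp
    have "w d * Q d c * (r m d - r m c)\<^sup>2 \<le> F m" for m
    proof -
      have "w d * Q d c * (r m d - r m c)\<^sup>2 \<le> (\<Sum>c\<in>G. w d * Q d c * (r m d - r m c)\<^sup>2)"
        using dc finite_states nn
        by (intro member_le_sum[where f = "\<lambda>c. w d * Q d c * (r m d - r m c)\<^sup>2"]) auto
      also have "\<dots> \<le> F m"
        unfolding F_def using dc finite_states
        by (intro member_le_sum[where f = "\<lambda>d. \<Sum>c\<in>G. w d * Q d c * (r m d - r m c)\<^sup>2"] sum_nonneg nn) auto
      finally show ?thesis .
    qed
    then have "(r m d - r m c)\<^sup>2 \<le> F m / (w d * Q d c)" for m
      using wQ by (simp add: pos_le_divide_eq mult.commute)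
    then have "(\<lambda>m. (r m d - r m c)\<^sup>2) \<longlonglongrightarrow> 0"
      by (intro Lim_null_comparison[OF always_eventually tendsto_divide_zero[OF F0]]) auto
    then show ?thesis by (simp add: tendsto_null_power)
  qed
  have diff: "(\<lambda>m. r m a - r m d) \<longlonglongrightarrow> 0" if d: "d \<in> G" for d
    using irreducible[OF a d]
  proof (induction rule: rtrancl_induct)
    case (step u v)
    then have "(\<lambda>m. (r m a - r m u) + (r m u - r m v)) \<longlonglongrightarrow> 0 + 0"
      by (intro tendsto_add step.IH edge) auto
    then show ?case by simp
  qed simp
  define W where "W = (\<Sum>d\<in>G. w d * q d)"
  have W: "W > 0" unfolding W_def using finite_states a wq by (intro sum_pos) auto
  have tot: "(\<Sum>d\<in>G. w d * q d * r m d) = 1" if "m \<ge> 1" for m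
  proof -
    have "(\<Sum>d\<in>G. V m d) = (\<Sum>i<m. \<Sum>d\<in>G. of_bool (y i = d))"
      unfolding V_def by (rule sum.swap)
    also have "\<dots> = real m"
      using finite_states y by (simp add: of_bool_def)
    finally have "(\<Sum>d\<in>G. V m d / real m) = 1"
      using that by (simp flip: sum_divide_distrib)
    moreover have "(\<Sum>d\<in>G. V m d / real m) = (\<Sum>d\<in>G. w d * q d * r m d)"
      by (intro sum.cong refl Vr)
    ultimately show ?thesis by simp
  qed
  \<comment> \<open>All values \<open>r m d\<close> approach \<open>r m a\<close>, while their
    average with weights \<open>w d * q d\<close> equals \<open>1 / W\<close> by \<open>tot\<close>.
    This yields the limit without showing beforehand that one exists.\<close>
  have "(\<lambda>m. ((\<Sum>d\<in>G. w d * q d * (r m a - r m d)) + 1) / W) \<longlonglongrightarrow> ((\<Sum>d\<in>G. w d * q d * 0) + 1) / W"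
    using W by (intro tendsto_intros diff) auto
  moreover have "((\<Sum>d\<in>G. w d * q d * (r m a - r m d)) + 1) / W = r m a" if "m \<ge> 1" for m
    using tot[OF that] W
    by (simp add: right_diff_distrib sum_subtractf W_def flip: sum_distrib_right)
  ultimately have "(\<lambda>m. r m a) \<longlonglongrightarrow> 1 / W"
    by (subst (asm) tendsto_cong[of _ "\<lambda>m. r m a"]) (auto intro!: eventually_sequentiallyI[of 1])
  then have "(\<lambda>m. w a * q a * r m a) \<longlonglongrightarrow> w a * q a * (1 / W)"
    by (rule tendsto_mult_left)
  then show ?thesis
    unfolding Vr[OF a, symmetric] V_def \<kappa>_def W_def by (simp add: mult_ac)
qed

section \<open>Almost sure ergodic averages per transition\<close>

lemma AE_transition_frequencies:
  "AE \<omega> in M. \<forall>c\<in>G. \<forall>d\<in>G.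
     (\<lambda>m. (\<Sum>i<m. of_bool (Y i \<omega> = c \<and> Y (Suc i) \<omega> = d) - of_bool (Y i \<omega> = c) * p c d) / real m) \<longlonglongrightarrow> 0"
  using transition_frequency finite_states by (intro AE_finite_allI) auto

lemma AE_visit_frequency:
  "AE \<omega> in M. \<forall>c\<in>G. (\<lambda>m. (\<Sum>i<m. of_bool (Y i \<omega> = c)) / real m) \<longlonglongrightarrow> \<kappa> * w c * q c"
  using AE_transition_frequencies AE_space
  by eventually_elim (use Y_in visit_frequency in blast)

theorem ergodic_transitions:
  fixes f :: "'b \<Rightarrow> 'b \<Rightarrow> real"
  shows "AE \<omega> in M. (\<lambda>m. (\<Sum>i<m. f (Y i \<omega>) (Y (Suc i) \<omega>)) / real m)
     \<longlonglongrightarrow> \<kappa> * (\<Sum>c\<in>G. w c * (\<Sum>d\<in>G. Q c d * f c d))"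
  using AE_transition_frequencies AE_visit_frequency AE_space
proof eventually_elim
  case (elim \<omega>)
  let ?N = "\<lambda>m c d. \<Sum>i<m. of_bool (Y i \<omega> = c \<and> Y (Suc i) \<omega> = d) :: real"
  have N: "(\<lambda>m. ?N m c d / real m) \<longlonglongrightarrow> \<kappa> * w c * Q c d" if cd: "c \<in> G" "d \<in> G" for c d
  proof -
    have "(\<lambda>m. (\<Sum>i<m. of_bool (Y i \<omega> = c \<and> Y (Suc i) \<omega> = d) - of_bool (Y i \<omega> = c) * p c d) / real m
        + (\<Sum>i<m. of_bool (Y i \<omega> = c)) / real m * p c d) \<longlonglongrightarrow> 0 + \<kappa> * w c * q c * p c d"
      using elim(1,2) cd by (intro tendsto_add tendsto_mult_right) auto
    moreover have "(\<Sum>i<m. of_bool (Y i \<omega> = c \<and> Y (Suc i) \<omega> = d) - of_bool (Y i \<omega> = c) * p c d) =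
        ?N m c d - (\<Sum>i<m. of_bool (Y i \<omega> = c)) * p c d" for m
      by (simp only: sum_subtractf sum_distrib_right)
    ultimately show ?thesis
      using rate_eq_jump_prob[OF cd] by (simp add: diff_divide_distrib mult.assoc)
  qed
  have "(\<lambda>m. \<Sum>c\<in>G. \<Sum>d\<in>G. f c d * (?N m c d / real m)) \<longlonglongrightarrow> (\<Sum>c\<in>G. \<Sum>d\<in>G. f c d * (\<kappa> * w c * Q c d))"
    by (intro tendsto_sum tendsto_mult_left N)
  moreover have "(\<Sum>c\<in>G. \<Sum>d\<in>G. f c d * (?N m c d / real m)) = (\<Sum>i<m. f (Y i \<omega>) (Y (Suc i) \<omega>)) / real m" for m
  proof -
    have "f (Y i \<omega>) (Y (Suc i) \<omega>) = (\<Sum>c\<in>G. \<Sum>d\<in>G. f c d * of_bool (Y i \<omega> = c \<and> Y (Suc i) \<omega> = d))" for i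
    proof -
      have "(\<Sum>c\<in>G. \<Sum>d\<in>G. f c d * of_bool (Y i \<omega> = c \<and> Y (Suc i) \<omega> = d)) =
         (\<Sum>c\<in>G. if Y i \<omega> = c then (\<Sum>d\<in>G. if Y (Suc i) \<omega> = d then f c d else 0) else 0)"
        by (intro sum.cong refl) (auto intro!: sum.cong)
      then show ?thesis
        using finite_states Y_in[OF elim(3)] by simp
    qed
    then have "(\<Sum>i<m. f (Y i \<omega>) (Y (Suc i) \<omega>)) = (\<Sum>i<m. \<Sum>c\<in>G. \<Sum>d\<in>G. f c d * of_bool (Y i \<omega> = c \<and> Y (Suc i) \<omega> = d))"
      by simp
    also have "\<dots> = (\<Sum>c\<in>G. \<Sum>i<m. \<Sum>d\<in>G. f c d * of_bool (Y i \<omega> = c \<and> Y (Suc i) \<omega> = d))"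
      by (rule sum.swap)
    also have "\<dots> = (\<Sum>c\<in>G. \<Sum>d\<in>G. \<Sum>i<m. f c d * of_bool (Y i \<omega> = c \<and> Y (Suc i) \<omega> = d))"
      by (intro sum.cong refl sum.swap)
    also have "\<dots> = (\<Sum>c\<in>G. \<Sum>d\<in>G. f c d * ?N m c d)"
      by (simp add: sum_distrib_left)
    finally show ?thesis
      by (simp only: sum_divide_distrib[of _ G] times_divide_eq_right)
  qed
  ultimately show ?case
    by (simp add: sum_distrib_left mult_ac)
qed

text \<open>Visits to \<open>c\<close> have frequency \<open>\<kappa> * w c * q c\<close> and mean
  length \<open>1 / q c\<close>; the exit rate cancels and the weights of the continuous-time chain
  remain.\<close>

theorem ergodic_occupation:
  fixes f :: "'b \<Rightarrow> real"
  shows "AE \<omega> in M. (\<lambda>m. (\<Sum>i<m. f (Y i \<omega>) * H i \<omega>) / real m) \<longlonglongrightarrow> \<kappa> * (\<Sum>c\<in>G. w c * f c)"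
proof -
  have "AE \<omega> in M. \<forall>c\<in>G. (\<lambda>m. (\<Sum>i<m. of_bool (Y i \<omega> = c) * H i \<omega> - of_bool (Y i \<omega> = c) / q c) / real m) \<longlonglongrightarrow> 0"
    using holding_average finite_states by (intro AE_finite_allI) auto
  then show ?thesis
    using AE_visit_frequency AE_space
  proof eventually_elim
    case (elim \<omega>)
    let ?O = "\<lambda>m c. \<Sum>i<m. of_bool (Y i \<omega> = c) * H i \<omega>"
    have O: "(\<lambda>m. ?O m c / real m) \<longlonglongrightarrow> \<kappa> * w c" if c: "c \<in> G" for c
    proof -
      have "(\<lambda>m. (\<Sum>i<m. of_bool (Y i \<omega> = c) * H i \<omega> - of_bool (Y i \<omega> = c) / q c) / real m
          + (\<Sum>i<m. of_bool (Y i \<omega> = c)) / real m / q c) \<longlonglongrightarrow> 0 + \<kappa> * w c * q c / q c"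
        using elim(1,2) c exit_rate_pos[OF c] by (intro tendsto_add tendsto_divide tendsto_const) auto
      moreover have "(\<Sum>i<m. of_bool (Y i \<omega> = c) * H i \<omega> - of_bool (Y i \<omega> = c) / q c) =
          ?O m c - (\<Sum>i<m. of_bool (Y i \<omega> = c)) / q c" for m
        by (simp only: sum_subtractf sum_divide_distrib)
      ultimately show ?thesis
        using exit_rate_pos[OF c] by (simp add: diff_divide_distrib mult.commute)
    qed
    have "(\<lambda>m. \<Sum>c\<in>G. f c * (?O m c / real m)) \<longlonglongrightarrow> (\<Sum>c\<in>G. f c * (\<kappa> * w c))"
      by (intro tendsto_sum tendsto_mult_left O)
    moreover have "(\<Sum>c\<in>G. f c * (?O m c / real m)) = (\<Sum>i<m. f (Y i \<omega>) * H i \<omega>) / real m" for m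
    proof -
      have "f (Y i \<omega>) * H i \<omega> = (\<Sum>c\<in>G. f c * (of_bool (Y i \<omega> = c) * H i \<omega>))" for i
      proof -
        have "(\<Sum>c\<in>G. f c * (of_bool (Y i \<omega> = c) * H i \<omega>)) = (\<Sum>c\<in>G. if Y i \<omega> = c then f c * H i \<omega> else 0)"
          by (intro sum.cong refl) auto
        then show ?thesis
          using finite_states Y_in[OF elim(3)] by simp
      qed
      then have "(\<Sum>i<m. f (Y i \<omega>) * H i \<omega>) = (\<Sum>i<m. \<Sum>c\<in>G. f c * (of_bool (Y i \<omega> = c) * H i \<omega>))"
        by simp
      also have "\<dots> = (\<Sum>c\<in>G. \<Sum>i<m. f c * (of_bool (Y i \<omega> = c) * H i \<omega>))"
        by (rule sum.swap)
      also have "\<dots> = (\<Sum>c\<in>G. f c * ?O m c)"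
        by (simp add: sum_distrib_left)
      finally show ?thesis
      by (simp only: sum_divide_distrib[of _ G] times_divide_eq_right)
    qed
    ultimately show ?case
      by (simp add: sum_distrib_left mult_ac)
  qed
qed

end

section \<open>Stationary weights of the exclusion process\<close>

lemma arrives_iff_departs: "arrives N k i c c' \<longleftrightarrow> departs N k i c' c \<and> c i = 0"
  by (auto simp: arrives_def departs_def fun_upd_idem)

lemma departs_vacates: "departs N k i c c' \<Longrightarrow> c' i = 0"
  by (auto simp: departs_def)

lemma hops_sym: "hops N k i j c c' \<longleftrightarrow> hops N k j i c' c"
proof -
  have "hops N k j i c' c" if "hops N k i j c c'" for i j c c'
  proof -
    have "i \<noteq> j" "c i = k" "c j = 0" and c': "c' = c(i := 0, j := k)"
      using that by (auto simp: hops_def)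
    then have "c = c'(j := 0, i := k)" "c' j = k" "c' i = 0" by (auto intro!: ext)
    then show ?thesis using that unfolding hops_def by blast
  qed
  then show ?thesis by blast
qed

text \<open>An arrival fills one vacant site and vacates none, whereas a departure or a hop of a
  particle vacates one. So the two configurations alone reveal an arrival, its site and its
  type.\<close>

lemma arrives_unique:
  assumes "arrives N k i c c'" "k \<noteq> 0"
  shows "arrives N k' i' c c' \<and> k' \<noteq> 0 \<longleftrightarrow> k' = k \<and> i' = i"
    and "\<not> (departs N k' i' c c' \<and> k' \<noteq> 0)"
    and "\<not> (hops N k' i' j c c' \<and> k' \<noteq> 0)"
proof -
  have i: "c i = 0" "c' i = k" and other: "l \<noteq> i \<Longrightarrow> c' l = c l" for l
    using assms by (auto simp: arrives_def)
  show "arrives N k' i' c c' \<and> k' \<noteq> 0 \<longleftrightarrow> k' = k \<and> i' = i"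
  proof
    assume a: "arrives N k' i' c c' \<and> k' \<noteq> 0"
    then have "c' i' = k'" "c i' = 0" by (auto simp: arrives_def)
    with a i other[of i'] show "k' = k \<and> i' = i" by auto
  qed (use assms in auto)
  have vacated: "c i' = 0 \<or> c' i' \<noteq> 0" for i'
    using i other[of i'] by (cases "i' = i") auto
  show "\<not> (departs N k' i' c c' \<and> k' \<noteq> 0)"
    using vacated[of i'] by (auto simp: departs_def)
  show "\<not> (hops N k' i' j c c' \<and> k' \<noteq> 0)"
    using vacated[of i'] by (auto simp: hops_def)
qed

text \<open>The support of the rates, as \<open>rate_pos_if_moves\<close> and
  \<open>moves_if_rate_nonzero\<close> show; it lets particles be followed without reference to the
  rates.\<close>

definition moves :: "nat \<Rightarrow> nat \<Rightarrow> config \<Rightarrow> config \<Rightarrow> bool" where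
  "moves N K c c' \<longleftrightarrow> (\<exists>k\<in>{1..K}. (\<exists>i. arrives N k i c c' \<or> departs N k i c c') \<or> (\<exists>i j. hops N k i j c c'))"

definition empty_config :: "nat \<Rightarrow> config" where
  "empty_config N = (\<lambda>i\<in>{1..N}. 0)"

lemma finite_configs: "finite (configs N K)"
  by (simp add: configs_def finite_PiE)

lemma configs_upd: "c \<in> configs N K \<Longrightarrow> i \<in> {1..N} \<Longrightarrow> a \<le> K \<Longrightarrow> c(i := a) \<in> configs N K"
  by (auto simp: configs_def PiE_def Pi_def extensional_def)

lemma empty_config_in: "empty_config N \<in> configs N K"
  by (auto simp: empty_config_def configs_def)

lemma empty_config_iff:
  "c \<in> configs N K \<Longrightarrow> c = empty_config N \<longleftrightarrow> (\<forall>i\<in>{1..N}. c i = 0)"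
  by (auto simp: empty_config_def configs_def PiE_def extensional_def fun_eq_iff)

lemma moves_irrefl: "\<not> moves N K c c"
proof
  assume "moves N K c c"
  then obtain k i j where "k \<in> {1..K}" "arrives N k i c c \<or> departs N k i c c \<or> hops N k i j c c"
    unfolding moves_def by blast
  moreover have "c i = 0 \<and> c i = k" if "arrives N k i c c"
    using that fun_upd_same[of c i k] by (simp add: arrives_def)
  moreover have "c i = 0 \<and> c i = k" if "departs N k i c c"
    using that fun_upd_same[of c i 0] by (simp add: departs_def)
  moreover have "c i = 0 \<and> c i = k" if "hops N k i j c c"
    using that hops_sym[of N k i j c c] by (auto simp: hops_def)
  ultimately show False by force
qed

locale exclusion =
  fixes N K :: nat and \<alpha> \<beta> \<delta> :: "nat \<Rightarrow> real"
  assumes N: "N \<ge> 2" and K: "K \<ge> 1"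
    and \<alpha>_pos: "\<And>k. k \<in> {1..K} \<Longrightarrow> \<alpha> k > 0"
    and \<beta>_pos: "\<And>k. k \<in> {1..K} \<Longrightarrow> \<beta> k > 0"
    and \<delta>_pos: "\<And>k. k \<in> {1..K} \<Longrightarrow> \<delta> k > 0"
begin

abbreviation rate :: "config \<Rightarrow> config \<Rightarrow> real" where "rate \<equiv> exclusion_rate N K \<alpha> \<beta> \<delta>"

abbreviation G :: "config set" where "G \<equiv> configs N K"

text \<open>Separated from the hops and by type because reversal respects both: an arrival is undone
  by a departure of the same type at the same site, a hop by the hop back.\<close>

definition boundary_rate :: "nat \<Rightarrow> config \<Rightarrow> config \<Rightarrow> real" where
  "boundary_rate k c c' = (\<Sum>i \<in> {1, N}. (if arrives N k i c c' then \<alpha> k else 0)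
                     + (if departs N k i c c' then \<beta> k else 0))"

definition hop_rate :: "nat \<Rightarrow> config \<Rightarrow> config \<Rightarrow> real" where
  "hop_rate k c c' = (\<Sum>i = 1..N. \<Sum>j = 1..N. if hops N k i j c c' then \<delta> k else 0)"

lemma rate_eq: "rate c c' = (\<Sum>k = 1..K. boundary_rate k c c' + hop_rate k c c')"
  by (simp only: exclusion_rate_def boundary_rate_def hop_rate_def)

lemma boundary_rate_nonneg: "k \<in> {1..K} \<Longrightarrow> boundary_rate k c c' \<ge> 0"
  using \<alpha>_pos[of k] \<beta>_pos[of k] unfolding boundary_rate_def by (intro sum_nonneg) auto

lemma hop_rate_nonneg: "k \<in> {1..K} \<Longrightarrow> hop_rate k c c' \<ge> 0"
  using \<delta>_pos[of k] unfolding hop_rate_def by (intro sum_nonneg) auto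

lemma rate_nonneg: "rate c c' \<ge> 0"
  unfolding rate_eq by (intro sum_nonneg add_nonneg_nonneg boundary_rate_nonneg hop_rate_nonneg)

lemma rate_pos_if_moves:
  assumes "moves N K c c'" shows "rate c c' > 0"
proof -
  obtain k where k: "k \<in> {1..K}"
    and m: "(\<exists>i. arrives N k i c c' \<or> departs N k i c c') \<or> (\<exists>i j. hops N k i j c c')"
    using assms unfolding moves_def by blast
  note pos = \<alpha>_pos[OF k] \<beta>_pos[OF k] \<delta>_pos[OF k]
  have "boundary_rate k c c' + hop_rate k c c' > 0"
    using m
  proof
    assume "\<exists>i. arrives N k i c c' \<or> departs N k i c c'"
    then obtain i where i: "arrives N k i c c' \<or> departs N k i c c'" ..
    then have "i \<in> {1, N}" by (auto simp: arrives_def departs_def)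
    then have "boundary_rate k c c' > 0"
      unfolding boundary_rate_def using i pos by (intro sum_pos2[where i = i]) auto
    then show ?thesis using hop_rate_nonneg[OF k, of c c'] by simp
  next
    assume "\<exists>i j. hops N k i j c c'"
    then obtain i j where h: "hops N k i j c c'" by blast
    then have "i \<in> {1..N}" "j \<in> {1..N}" by (auto simp: hops_def)
    then have "hop_rate k c c' > 0"
      unfolding hop_rate_def using h pos
      by (intro sum_pos2[where i = i] sum_pos2[where i = j] sum_nonneg) auto
    then show ?thesis using boundary_rate_nonneg[OF k, of c c'] by simp
  qed
  then show ?thesis
    unfolding rate_eq using k
    by (intro sum_pos2[where i = k] add_nonneg_nonneg boundary_rate_nonneg hop_rate_nonneg) auto
qed

lemma moves_if_rate_nonzero:
  assumes "rate c c' \<noteq> 0" shows "moves N K c c'"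
proof (rule ccontr)
  assume "\<not> moves N K c c'"
  then have "boundary_rate k c c' + hop_rate k c c' = 0" if "k \<in> {1..K}" for k
    using that by (auto simp: moves_def boundary_rate_def hop_rate_def)
  then show False
    using assms by (simp add: rate_eq)
qed

lemma rate_self: "rate c c = 0"
  using moves_if_rate_nonzero moves_irrefl by blast

lemma rate_arrives:
  assumes a: "arrives N k i c c'" and k: "k \<in> {1..K}"
  shows "rate c c' = \<alpha> k"
proof -
  have i: "i \<in> {1, N}" using a by (simp add: arrives_def)
  have k0: "k \<noteq> 0" using k by simp
  note u = arrives_unique[OF a k0]
  have "rate c c' = (\<Sum>l = 1..K. if l = k then \<alpha> k else 0)"
    unfolding rate_eq
  proof (intro sum.cong refl)
    fix l assume l: "l \<in> {1..K}"
    have "hop_rate l c c' = 0"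
      using u(3)[of l] l unfolding hop_rate_def by (intro sum.neutral ballI) auto
    moreover have "boundary_rate l c c' = (\<Sum>j\<in>{1, N}. if l = k \<and> j = i then \<alpha> k else 0)"
      unfolding boundary_rate_def using u(1)[of l] u(2)[of l] l by (intro sum.cong refl) auto
    moreover have "\<dots> = (if l = k then \<alpha> k else 0)"
      using i by (cases "l = k") (simp_all add: sum.delta)
    ultimately show "boundary_rate l c c' + hop_rate l c c' = (if l = k then \<alpha> k else 0)"
      by simp
  qed
  then show ?thesis using k by simp
qed

section \<open>Product weights and detailed balance\<close>

definition \<rho> :: "nat \<Rightarrow> real" where "\<rho> a = (if a = 0 then 1 else \<alpha> a / \<beta> a)"

definition weight :: "config \<Rightarrow> real" where "weight c = (\<Prod>i = 1..N. \<rho> (c i))"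

lemma \<rho>_pos: "a \<le> K \<Longrightarrow> \<rho> a > 0"
  using \<alpha>_pos[of a] \<beta>_pos[of a] by (auto simp: \<rho>_def)

lemma weight_pos: "c \<in> G \<Longrightarrow> weight c > 0"
  unfolding weight_def by (intro prod_pos \<rho>_pos) (auto simp: configs_def)

lemma weight_upd:
  assumes "i \<in> {1..N}"
  shows "weight (c(i := a)) * \<rho> (c i) = weight c * \<rho> a"
proof -
  have "weight c' = \<rho> (c' i) * (\<Prod>l\<in>{1..N} - {i}. \<rho> (c' l))" for c'
    unfolding weight_def using assms by (intro prod.remove) auto
  moreover have "(\<Prod>l\<in>{1..N} - {i}. \<rho> ((c(i := a)) l)) = (\<Prod>l\<in>{1..N} - {i}. \<rho> (c l))"
    by (intro prod.cong) auto
  ultimately show ?thesis by simp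
qed

lemma weight_arrives:
  assumes "arrives N k i c c'" "k \<in> {1..K}"
  shows "weight c * \<alpha> k = weight c' * \<beta> k"
proof -
  have "i \<in> {1..N}" "c i = 0" "c' = c(i := k)" using assms N by (auto simp: arrives_def)
  then show ?thesis
    using weight_upd[of i c k] assms(2) \<beta>_pos[OF assms(2)] by (auto simp: \<rho>_def field_simps)
qed

lemma weight_hops:
  assumes "hops N k i j c c'" "k \<in> {1..K}"
  shows "weight c = weight c'"
proof -
  have ij: "i \<in> {1..N}" "j \<in> {1..N}" "i \<noteq> j" "c i = k" "c j = 0" "c' = c(i := 0, j := k)"
    using assms by (auto simp: hops_def)
  have "weight (c(i := 0)) * \<rho> k = weight c"
    using weight_upd[of i c 0] ij by (simp add: \<rho>_def)
  moreover have "weight (c(i := 0, j := k)) = weight (c(i := 0)) * \<rho> k"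
    using weight_upd[of j "c(i := 0)" k] ij by (simp add: \<rho>_def)
  ultimately show ?thesis using ij by simp
qed

lemma boundary_rate_balance:
  assumes k: "k \<in> {1..K}"
  shows "weight c * boundary_rate k c c' = weight c' * boundary_rate k c' c"
proof -
  have *: "weight c * (if arrives N k i c c' then \<alpha> k else 0) = weight c' * (if departs N k i c' c then \<beta> k else 0)" for c c' i
    using weight_arrives[OF _ k, of i c c'] arrives_iff_departs[of N k i c c'] departs_vacates[of N k i c' c] by auto
  show ?thesis
    unfolding boundary_rate_def sum_distrib_left
  proof (intro sum.cong refl)
    fix i
    show "weight c * ((if arrives N k i c c' then \<alpha> k else 0) + (if departs N k i c c' then \<beta> k else 0)) =
        weight c' * ((if arrives N k i c' c then \<alpha> k else 0) + (if departs N k i c' c then \<beta> k else 0))"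
      unfolding distrib_left using *[of c i c'] *[of c' i c] by linarith
  qed
qed

lemma hop_rate_balance:
  assumes k: "k \<in> {1..K}"
  shows "weight c * hop_rate k c c' = weight c' * hop_rate k c' c"
proof -
  have "weight c * hop_rate k c c' = (\<Sum>i = 1..N. \<Sum>j = 1..N. weight c' * (if hops N k j i c' c then \<delta> k else 0))"
    unfolding hop_rate_def sum_distrib_left
    using weight_hops[OF _ k] hops_sym by (intro sum.cong refl) auto
  also have "\<dots> = (\<Sum>j = 1..N. \<Sum>i = 1..N. weight c' * (if hops N k j i c' c then \<delta> k else 0))"
    by (rule sum.swap)
  finally show ?thesis by (simp only: hop_rate_def sum_distrib_left)
qed

lemma rate_balance: "weight c * rate c c' = weight c' * rate c' c"
proof -
  have "weight c * (boundary_rate k c c' + hop_rate k c c') = weight c' * (boundary_rate k c' c + hop_rate k c' c)"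
    if "k \<in> {1..K}" for k
    using boundary_rate_balance[OF that, of c c'] hop_rate_balance[OF that, of c c']
    by (simp only: distrib_left)
  then show ?thesis
    unfolding rate_eq sum_distrib_left by (intro sum.cong refl)
qed

section \<open>Positive exit rates and irreducibility\<close>

lemma moves_in_configs: "moves N K c c' \<Longrightarrow> c \<in> G \<Longrightarrow> c' \<in> G"
  using N by (auto simp: moves_def arrives_def departs_def hops_def intro!: configs_upd)

lemma exit_rate_pos:
  assumes c: "c \<in> G" shows "exit_rate G rate c > 0"
proof -
  have "\<exists>c'. moves N K c c'"
  proof (cases "c 1 = 0")
    case True
    then have "arrives N 1 1 c (c(1 := 1))" by (simp add: arrives_def)
    then show ?thesis using K by (force simp: moves_def)
  next
    case False
    moreover have "c 1 \<in> {0..K}" using c N by (auto simp: configs_def)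
    ultimately have "c 1 \<in> {1..K}" "departs N (c 1) 1 c (c(1 := 0))" by (auto simp: departs_def)
    then show ?thesis unfolding moves_def by blast
  qed
  then obtain c' where m: "moves N K c c'" ..
  then have "c' \<in> G - {c}" using moves_in_configs[OF m c] moves_irrefl by blast
  then show ?thesis
    unfolding exit_rate_def using rate_pos_if_moves[OF m] rate_nonneg finite_configs
    by (intro sum_pos2[where i = c']) auto
qed

text \<open>The leftmost particle can always move one step to the left or leave through site 1.\<close>

lemma reaches_empty:
  assumes "c \<in> G"
  shows "(c, empty_config N) \<in> {(c, d). c \<in> G \<and> d \<in> G \<and> rate c d > 0}\<^sup>*"
  using assms
\<comment> \<open>The induction measure is the sum of the positions of all particles; a step to the
  left and a departure from site 1 both lower it by 1.\<close>
proof (induction "\<Sum>i = 1..N. if c i = 0 then 0 else i" arbitrary: c rule: less_induct)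
  case less
  show ?case
  proof (cases "c = empty_config N")
    case False
    define i where "i = (LEAST i. i \<in> {1..N} \<and> c i \<noteq> 0)"
    have ex: "\<exists>i. i \<in> {1..N} \<and> c i \<noteq> 0"
      using empty_config_iff[OF less.prems] False by blast
    have i: "i \<in> {1..N}" "c i \<noteq> 0"
      using LeastI_ex[OF ex] unfolding i_def by auto
    have before: "c l = 0" if "l \<in> {1..N}" "l < i" for l
      using not_less_Least[of l "\<lambda>i. i \<in> {1..N} \<and> c i \<noteq> 0"] that unfolding i_def by auto
    have ci: "c i \<in> {1..K}" using i less.prems by (auto simp: configs_def Pi_def PiE_def)
    let ?s = "\<lambda>c. \<Sum>i = 1..N. if c i = 0 then 0 else i"
    have sum_upd: "(\<Sum>l = 1..N. if (c(i := 0)) l = 0 then 0 else l) + i = ?s c"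
      if "i \<in> {1..N}" "c i \<noteq> 0" for c :: config and i
    proof -
      have "(\<Sum>l = 1..N. if (c(i := 0)) l = 0 then 0 else l) = (\<Sum>l\<in>{1..N} - {i}. if c l = 0 then 0 else l)"
        using that by (intro sum.mono_neutral_cong_right) auto
      then show ?thesis
        using sum.remove[of "{1..N}" i "\<lambda>l. if c l = 0 then 0 else l"] that by simp
    qed
    have "\<exists>c'. moves N K c c' \<and> ?s c' < ?s c"
    proof (cases "i = 1")
      case True
      then have "departs N (c i) i c (c(i := 0))" by (simp add: departs_def)
      then have "moves N K c (c(i := 0))" using ci unfolding moves_def by blast
      then show ?thesis using sum_upd[of i c] i True by (intro exI[of _ "c(i := 0)"]) auto
    next
      case False
      define j where "j = i - 1"
      have j: "j \<in> {1..N}" "i = j + 1"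
        using False i(1) unfolding j_def by auto
      then have cj: "c j = 0" using before by simp
      let ?c' = "c(i := 0, j := c i)"
      have "hops N (c i) i j c ?c'" using i j cj by (simp add: hops_def)
      then have "moves N K c ?c'" using ci unfolding moves_def by blast
      moreover have "?s ?c' < ?s c"
      proof -
        \<comment> \<open>Without the moved particle the two configurations coincide, so their
          measures differ only by \<open>i\<close> against \<open>j\<close>.\<close>
        have "?c'(j := 0) = c(i := 0)" using j cj by (auto simp: fun_eq_iff)
        then show ?thesis
          using sum_upd[of i c] sum_upd[of j ?c'] i j by simp
      qed
      ultimately show ?thesis by blast
    qed
    then obtain c' where m: "moves N K c c'" and lt: "?s c' < ?s c" by blast
    have c': "c' \<in> G" using moves_in_configs[OF m less.prems] .
    show ?thesis
      using less.hyps[OF lt c'] rate_pos_if_moves[OF m] less.prems c'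
      by (intro converse_rtrancl_into_rtrancl[of c c']) auto
  qed simp
qed

text \<open>Detailed balance makes positivity of the rates symmetric, so a path from
  \<open>d\<close> to the empty configuration can be reversed and appended to one from
  \<open>c\<close>.\<close>

lemma rates_irreducible:
  assumes c: "c \<in> G" and d: "d \<in> G"
  shows "(c, d) \<in> {(c, d). c \<in> G \<and> d \<in> G \<and> rate c d > 0}\<^sup>*"
proof -
  let ?E = "{(c, d). c \<in> G \<and> d \<in> G \<and> rate c d > 0}"
  have "rate d c > 0" if "c \<in> G" "d \<in> G" "rate c d > 0" for c d
  proof -
    have "weight d * rate d c > 0"
      using that weight_pos[of c] by (simp flip: rate_balance[of c d])
    then show ?thesis using weight_pos[OF that(2)] by (simp add: zero_less_mult_iff)
  qed
  then have "sym ?E" by (auto simp: sym_def)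
  then have "(empty_config N, d) \<in> ?E\<^sup>*"
    by (rule symD[OF sym_rtrancl reaches_empty[OF d]])
  then show ?thesis
    by (rule rtrancl_trans[OF reaches_empty[OF c]])
qed

section \<open>Stationary means of occupation and entry\<close>

definition Z :: real where "Z = (\<Sum>a = 0..K. \<rho> a)"

lemma Z_pos: "Z > 0"
  unfolding Z_def using \<rho>_pos by (intro sum_pos) auto

lemma weight_marginal:
  assumes i: "i \<in> {1..N}" and a: "a \<le> K"
  shows "(\<Sum>c\<in>G. weight c * of_bool (c i = a)) = \<rho> a * Z ^ (N - 1)"
proof -
  \<comment> \<open>The indicator is absorbed into the factor of site \<open>i\<close>, so the
    summand stays a product over the sites and the sum factorises.\<close>
  define f where "f = (\<lambda>l b. \<rho> b * (if l = i then of_bool (b = a) else 1))"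
  have "(\<Sum>c\<in>G. weight c * of_bool (c i = a)) = (\<Sum>c\<in>{1..N} \<rightarrow>\<^sub>E {0..K}. \<Prod>l\<in>{1..N}. f l (c l))"
    unfolding configs_def
  proof (intro sum.cong refl)
    fix c
    have "(\<Prod>l\<in>{1..N}. if l = i then of_bool (c l = a) else (1::real)) = of_bool (c i = a)"
      using i by simp
    then show "weight c * of_bool (c i = a) = (\<Prod>l\<in>{1..N}. f l (c l))"
      unfolding weight_def f_def prod.distrib by simp
  qed
  also have "\<dots> = (\<Prod>l\<in>{1..N}. \<Sum>b\<in>{0..K}. f l b)"
    by (rule prod_sum_PiE[symmetric]) auto
  also have "\<dots> = (\<Sum>b\<in>{0..K}. f i b) * (\<Prod>l\<in>{1..N} - {i}. \<Sum>b\<in>{0..K}. f l b)"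
    using i by (intro prod.remove) auto
  also have "(\<Sum>b\<in>{0..K}. f i b) = (\<Sum>b\<in>{0..K}. if b = a then \<rho> b else 0)"
    by (intro sum.cong) (auto simp: f_def)
  also have "\<dots> = \<rho> a" using a by simp
  also have "(\<Prod>l\<in>{1..N} - {i}. \<Sum>b\<in>{0..K}. f l b) = (\<Prod>l\<in>{1..N} - {i}. Z)"
    by (intro prod.cong) (auto simp: f_def Z_def)
  finally show ?thesis using i by simp
qed

lemma mean_occupation:
  assumes "k \<in> {1..K}"
  shows "(\<Sum>c\<in>G. weight c * real (card {i\<in>{1..N}. c i = k})) = real N * (\<rho> k * Z ^ (N - 1))"
proof -
  have "(\<Sum>c\<in>G. weight c * real (card {i\<in>{1..N}. c i = k})) = (\<Sum>c\<in>G. \<Sum>i = 1..N. weight c * of_bool (c i = k))"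
    by (intro sum.cong refl) (simp add: Int_def flip: sum_distrib_left del: sum_mult_of_bool_eq)
  also have "\<dots> = (\<Sum>i = 1..N. \<Sum>c\<in>G. weight c * of_bool (c i = k))"
    by (rule sum.swap)
  also have "\<dots> = (\<Sum>i = 1..N. \<rho> k * Z ^ (N - 1))"
    using assms by (intro sum.cong weight_marginal) auto
  finally show ?thesis by simp
qed

lemma entry_rate:
  assumes c: "c \<in> G" and k: "k \<in> {1..K}"
  shows "(\<Sum>d\<in>G. rate c d * of_bool (\<exists>i. arrives N k i c d)) = \<alpha> k * (of_bool (c 1 = 0) + of_bool (c N = 0))"
proof -
  \<comment> \<open>Each of the two ends has a single target \<open>c(i := k)\<close>, so after
    exchanging sums the sum over \<open>d\<close> picks it out; \<open>arrives_unique\<close>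
    excludes double counting.\<close>
  have "rate c d * of_bool (\<exists>i. arrives N k i c d) = (\<Sum>i\<in>{1, N}. if d = c(i := k) then \<alpha> k * of_bool (c i = 0) else 0)" for d
  proof (cases "\<exists>i. arrives N k i c d")
    case True
    then obtain i0 where a: "arrives N k i0 c d" ..
    have "(\<Sum>i\<in>{1, N}. if d = c(i := k) then \<alpha> k * of_bool (c i = 0) else 0) =
        (\<Sum>i\<in>{1, N}. if i = i0 then \<alpha> k else 0)"
    proof (intro sum.cong refl)
      fix i assume "i \<in> {1, N}"
      then have "d = c(i := k) \<and> c i = 0 \<longleftrightarrow> arrives N k i c d" by (auto simp: arrives_def)
      then show "(if d = c(i := k) then \<alpha> k * of_bool (c i = 0) else 0) = (if i = i0 then \<alpha> k else 0)"
        using arrives_unique(1)[OF a, of k i] k by auto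
    qed
    also have "\<dots> = \<alpha> k" using a by (subst sum.delta) (auto simp: arrives_def)
    finally show ?thesis using True rate_arrives[OF a k] by simp
  next
    case False
    then have "(if d = c(i := k) then \<alpha> k * of_bool (c i = 0) else 0) = 0" if "i \<in> {1, N}" for i
      using that by (auto simp: arrives_def)
    then show ?thesis using False by simp
  qed
  then have "(\<Sum>d\<in>G. rate c d * of_bool (\<exists>i. arrives N k i c d)) =
      (\<Sum>i\<in>{1, N}. \<Sum>d\<in>G. if d = c(i := k) then \<alpha> k * of_bool (c i = 0) else 0)"
    by (simp only:) (rule sum.swap)
  also have "\<dots> = (\<Sum>i\<in>{1, N}. \<alpha> k * of_bool (c i = 0))"
    using c k N finite_configs configs_upd[OF c, of _ k] by (intro sum.cong refl) auto
  finally show ?thesis using N by (simp add: distrib_left)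
qed

lemma mean_entry_rate:
  assumes k: "k \<in> {1..K}"
  shows "(\<Sum>c\<in>G. weight c * (\<Sum>d\<in>G. rate c d * of_bool (\<exists>i. arrives N k i c d))) = 2 * \<alpha> k * Z ^ (N - 1)"
proof -
  have "(\<Sum>c\<in>G. weight c * (\<Sum>d\<in>G. rate c d * of_bool (\<exists>i. arrives N k i c d))) =
      (\<Sum>c\<in>G. \<alpha> k * (weight c * of_bool (c 1 = 0) + weight c * of_bool (c N = 0)))"
    by (intro sum.cong refl) (simp only: entry_rate[OF _ k] algebra_simps)
  also have "\<dots> = \<alpha> k * ((\<Sum>c\<in>G. weight c * of_bool (c 1 = 0)) + (\<Sum>c\<in>G. weight c * of_bool (c N = 0)))"
    by (simp only: sum.distrib flip: sum_distrib_left)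
  also have "\<dots> = \<alpha> k * (\<rho> 0 * Z ^ (N - 1) + \<rho> 0 * Z ^ (N - 1))"
    using N by (subst (1 2) weight_marginal) auto
  finally show ?thesis by (simp add: \<rho>_def)
qed

end

section \<open>Following particles\<close>

lemma next_site_stay:
  assumes "c i \<noteq> 0" "c' i = c i"
  shows "next_site N c c' i = Some i"
proof -
  have "\<not> departs N (c i) i c c'" using assms by (auto simp: departs_def)
  moreover have "\<not> hops N (c i) i j c c'" for j using assms by (auto simp: hops_def)
  ultimately show ?thesis by (simp add: next_site_def)
qed

lemma next_site_hop:
  assumes h: "hops N k i j c c'" and k: "k \<noteq> 0"
  shows "next_site N c c' i = Some j"
proof -
  have c: "c i = k" "c j = 0" "c' j = k" and other: "\<And>l. l \<noteq> i \<Longrightarrow> l \<noteq> j \<Longrightarrow> c' l = c l"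
    using h by (auto simp: hops_def)
  have "\<not> departs N (c i) i c c'"
  proof
    assume "departs N (c i) i c c'"
    then have "c' j = (c(i := 0)) j" by (simp add: departs_def)
    then show False using c k by (auto split: if_splits)
  qed
  moreover have hop: "hops N (c i) i j c c'" using h c by simp
  moreover have "(THE j. hops N (c i) i j c c') = j"
  proof (rule the_equality, rule hop, rule ccontr)
    fix j' assume h': "hops N (c i) i j' c c'" and "j' \<noteq> j"
    moreover have "c' j' = c i" "c j' = 0" "j' \<noteq> i"
      using h' by (auto simp: hops_def)
    ultimately show False using other[of j'] c k by simp
  qed
  ultimately show ?thesis
    unfolding next_site_def by (simp only: if_False) (metis hop)
qed

lemma next_site_departs:
  assumes "departs N k i c c'"
  shows "next_site N c c' i = None"
proof -
  have "departs N (c i) i c c'" using assms by (simp add: departs_def)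
  then show ?thesis by (simp add: next_site_def)
qed

context
  fixes N K :: nat and c c' :: config
  assumes N: "N \<ge> 2" and moves: "moves N K c c'"
begin

text \<open>The single case analysis behind the lemmas that follow. Together they say that
  \<open>next_site\<close> maps the particles that stay injectively and with their types to the
  particles of \<open>c'\<close>, missing only one that has just arrived.\<close>

lemma next_site_cases:
  obtains (arrive) k i where "k \<noteq> 0" "arrives N k i c c'" "c i = 0" "i \<in> {1..N}"
      "c' i = k" "\<And>l. l \<noteq> i \<Longrightarrow> c' l = c l" "\<And>l. c l \<noteq> 0 \<Longrightarrow> next_site N c c' l = Some l"
  | (depart) i where "\<And>k j. k \<noteq> 0 \<Longrightarrow> \<not> arrives N k j c c'" "c' i = 0" "\<And>l. l \<noteq> i \<Longrightarrow> c' l = c l"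
      "\<And>l. c l \<noteq> 0 \<Longrightarrow> next_site N c c' l = (if l = i then None else Some l)"
  | (hop) i j where "\<And>k l. k \<noteq> 0 \<Longrightarrow> \<not> arrives N k l c c'" "i \<noteq> j" "i \<in> {1..N}" "j \<in> {1..N}" "c j = 0"
      "c i \<noteq> 0" "c' j = c i" "c' i = 0" "\<And>l. l \<noteq> i \<Longrightarrow> l \<noteq> j \<Longrightarrow> c' l = c l"
      "\<And>l. c l \<noteq> 0 \<Longrightarrow> next_site N c c' l = (if l = i then Some j else Some l)"
proof -
  obtain k where "k \<in> {1..K}"
    and m: "(\<exists>i. arrives N k i c c' \<or> departs N k i c c') \<or> (\<exists>i j. hops N k i j c c')"
    using moves unfolding moves_def by blast
  then have k: "k \<noteq> 0" by simp
  consider i where "arrives N k i c c'" | i where "departs N k i c c'" | i j where "hops N k i j c c'"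
    using m by blast
  then show thesis
  proof cases
    case 1
    then have i: "c i = 0" "i \<in> {1..N}" "c' i = k" and other: "\<And>l. l \<noteq> i \<Longrightarrow> c' l = c l"
      using N by (auto simp: arrives_def)
    have "next_site N c c' l = Some l" if "c l \<noteq> 0" for l
      using that i(1) by (intro next_site_stay other) auto
    with k 1 i other show thesis by (intro arrive)
  next
    case 2
    then have i: "c' i = 0" and other: "\<And>l. l \<noteq> i \<Longrightarrow> c' l = c l"
      by (auto simp: departs_def)
    have "next_site N c c' l = (if l = i then None else Some l)" if "c l \<noteq> 0" for l
    proof (cases "l = i")
      case True
      then show ?thesis using next_site_departs[OF 2] by simp
    next
      case False
      then show ?thesis using next_site_stay[of c l c' N] that other[of l] by simp
    qed
    moreover have "\<not> arrives N k' j c c'" if "k' \<noteq> 0" for k' j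
      using arrives_unique(2)[of N k' j c c' k i] 2 k that by blast
    ultimately show thesis using i other by (intro depart)
  next
    case 3
    then have ij: "i \<noteq> j" "i \<in> {1..N}" "j \<in> {1..N}" "c j = 0" "c i \<noteq> 0" "c' j = c i" "c' i = 0"
      and other: "\<And>l. l \<noteq> i \<Longrightarrow> l \<noteq> j \<Longrightarrow> c' l = c l"
      using k by (auto simp: hops_def)
    have "next_site N c c' l = (if l = i then Some j else Some l)" if "c l \<noteq> 0" for l
    proof (cases "l = i")
      case True
      then show ?thesis using next_site_hop[OF 3 k] by simp
    next
      case False
      moreover have "l \<noteq> j" using that ij(4) by auto
      ultimately show ?thesis using next_site_stay[of c l c' N] that other[of l] by simp
    qed
    moreover have "\<not> arrives N k' l c c'" if "k' \<noteq> 0" for k' l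
      using arrives_unique(3)[of N k' l c c' k i j] 3 k that by blast
    ultimately show thesis using ij other by (intro hop)
  qed
qed

lemma next_site_keeps_type:
  assumes i: "i \<in> {1..N}" "c i \<noteq> 0" and next_i: "next_site N c c' i = Some j"
  shows "j \<in> {1..N} \<and> c' j = c i"
proof (cases rule: next_site_cases)
  case (arrive k i0)
  have "j = i" using arrive(7)[OF i(2)] next_i by simp
  moreover have "i \<noteq> i0" using i(2) arrive(3) by auto
  ultimately show ?thesis using arrive(6) i(1) by simp
next
  case (depart i0)
  have "j = i \<and> i \<noteq> i0" using depart(4)[OF i(2)] next_i by (simp split: if_splits)
  then show ?thesis using depart(3) i(1) by simp
next
  case (hop i0 j0)
  have "i \<noteq> j0" using i(2) hop(5) by auto
  then show ?thesis using hop(10)[OF i(2)] next_i hop(4,7,9) i(1) by (cases "i = i0") auto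
qed

lemma next_site_inj:
  assumes i: "c i \<noteq> 0" "c i' \<noteq> 0" and eq: "next_site N c c' i = Some j" "next_site N c c' i' = Some j"
  shows "i = i'"
proof (cases rule: next_site_cases)
  case (arrive k i0)
  then show ?thesis using arrive(7)[OF i(1)] arrive(7)[OF i(2)] eq by simp
next
  case (depart i0)
  then show ?thesis using depart(4)[OF i(1)] depart(4)[OF i(2)] eq by (simp split: if_splits)
next
  case (hop i0 j0)
  have "i \<noteq> j0" "i' \<noteq> j0" using i hop(5) by auto
  then show ?thesis using hop(10)[OF i(1)] hop(10)[OF i(2)] eq by (simp split: if_splits)
qed

lemma next_site_surj:
  assumes "j \<in> {1..N}" "c' j \<noteq> 0"
  shows "(\<exists>i\<in>{1..N}. c i = c' j \<and> next_site N c c' i = Some j) \<or> arrives N (c' j) j c c'"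
proof (cases rule: next_site_cases)
  case (arrive k i)
  then show ?thesis using assms arrive(7)[of j] by (cases "j = i") auto
next
  case (depart i)
  have "j \<noteq> i" using assms(2) depart(2) by auto
  then show ?thesis using assms depart(3)[of j] depart(4)[of j] by auto
next
  case (hop i l)
  have "j \<noteq> i" using assms(2) hop(8) by auto
  then show ?thesis
    using assms hop(3,6,7) hop(9)[of j] hop(10)[of j] hop(10)[of i] by (cases "j = l") auto
qed

lemma arrives_not_next_site:
  assumes "arrives N k j c c'" "k \<noteq> 0" "c i \<noteq> 0"
  shows "next_site N c c' i \<noteq> Some j"
proof (cases rule: next_site_cases)
  case (arrive k' i')
  moreover have "c j = 0" using assms(1) by (simp add: arrives_def)
  ultimately show ?thesis using assms(3) arrive(7)[of i] by auto
next
  case (depart i')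
  then show ?thesis using assms(1,2) by blast
next
  case (hop i' l)
  then show ?thesis using assms(1,2) by blast
qed

end

text \<open>
  A particle (identified by the index \<open>n\<close> of its entry) is at site \<open>i\<close> just before
  transition \<open>l\<close>, that is, while the configuration is \<open>jump_state p l\<close>.
\<close>

definition at_site :: "nat \<Rightarrow> nat \<Rightarrow> (real \<Rightarrow> config) \<Rightarrow> nat \<Rightarrow> nat \<Rightarrow> nat \<Rightarrow> bool" where
  "at_site N k p n l i \<longleftrightarrow> n \<in> entries N k p \<and> n < l \<and> particle_site N k p n (l - Suc n) = Some i"

definition present :: "nat \<Rightarrow> nat \<Rightarrow> (real \<Rightarrow> config) \<Rightarrow> nat \<Rightarrow> nat \<Rightarrow> bool" where
  "present N k p n l \<longleftrightarrow> (\<exists>i. at_site N k p n l i)"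

abbreviation occupation :: "nat \<Rightarrow> nat \<Rightarrow> config \<Rightarrow> nat" where
  "occupation N k c \<equiv> card {i\<in>{1..N}. c i = k}"

lemma present_less: "present N k p n l \<Longrightarrow> n < l"
  by (auto simp: present_def at_site_def)

lemma particle_site_None_mono:
  "particle_site N k p n m = None \<Longrightarrow> m \<le> m' \<Longrightarrow> particle_site N k p n m' = None"
  by (rule dec_induct[of m m']) auto

text \<open>A sojourn time written as a sum over transitions allows the sums over particles and over
  time to be exchanged.\<close>

lemma sojourn_time_eq_sum:
  assumes n: "n \<in> entries N k p" "n < e" and gone: "\<not> present N k p n e"
  shows "sojourn_time N k p n = ereal (\<Sum>l<e. of_bool (present N k p n l) * holding_time p l)"
proof -
  let ?P = "\<lambda>m. particle_site N k p n m = None"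
  define m where "m = (LEAST m. ?P m)"
  have Pe: "?P (e - Suc n)"
    using n gone by (auto simp: present_def at_site_def)
  then have Pm: "?P m" and me: "m \<le> e - Suc n"
    unfolding m_def by (rule LeastI, rule Least_le)
  have P_iff: "?P m' \<longleftrightarrow> m \<le> m'" for m'
    using particle_site_None_mono[OF Pm] Least_le[of ?P m'] unfolding m_def by blast
  \<comment> \<open>The particle enters at the start of state \<open>Suc n\<close> and leaves at the
    end of state \<open>n + m\<close>, so it is present in exactly \<open>m\<close> consecutive
    states.\<close>
  have present_iff: "present N k p n l \<longleftrightarrow> Suc n \<le> l \<and> l < Suc n + m" for l
  proof -
    have "present N k p n l \<longleftrightarrow> n < l \<and> \<not> ?P (l - Suc n)"
      using n(1) by (auto simp: present_def at_site_def)
    then show ?thesis unfolding P_iff by auto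
  qed
  have "(\<Sum>l<e. of_bool (present N k p n l) * holding_time p l) = (\<Sum>l\<in>{Suc n..<Suc n + m}. holding_time p l)"
    using me n(2) by (intro sum.mono_neutral_cong_right) (auto simp: present_iff)
  also have "\<dots> = jump_time p (Suc n + m) - jump_time p (Suc n)"
    by (simp only: jump_time_eq_sum lessThan_atLeast0)
      (metis add_diff_cancel_left' le_add1 sum.atLeastLessThan_concat zero_le)
  finally show ?thesis
    using Pm unfolding sojourn_time_def m_def by auto
qed

section \<open>Particles followed along one path\<close>

locale exclusion_path = exclusion +
  fixes p :: "real \<Rightarrow> config" and k :: nat
  assumes k: "k \<in> {1..K}"
    and path_in: "\<And>n. jump_state p n \<in> configs N K"
    and path_moves: "\<And>n. moves N K (jump_state p n) (jump_state p (Suc n))"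
begin

abbreviation Y :: "nat \<Rightarrow> config" where "Y \<equiv> jump_state p"

abbreviation H :: "nat \<Rightarrow> real" where "H \<equiv> holding_time p"

lemma k_nonzero: "k \<noteq> 0" using k by simp

text \<open>Replaces the recursion of \<open>particle_site\<close> on the age of a particle by one
  on the common index \<open>l\<close>, so that different particles can be compared at the same
  moment.\<close>

lemma at_site_Suc:
  "at_site N k p n (Suc l) j \<longleftrightarrow>
     (\<exists>i. at_site N k p n l i \<and> next_site N (Y l) (Y (Suc l)) i = Some j) \<or>
     n = l \<and> arrives N k j (Y l) (Y (Suc l))"
proof (cases "n < l")
  case True
  then have "Suc l - Suc n = Suc (l - Suc n)" "Suc (n + (l - Suc n)) = l" by auto
  then show ?thesis
    using True unfolding at_site_def by (auto split: option.splits)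
next
  case False
  have the: "(THE i. arrives N k i (Y l) (Y (Suc l))) = j" if "arrives N k j (Y l) (Y (Suc l))" for j
    using that arrives_unique(1)[OF that k_nonzero] k_nonzero by (intro the_equality) auto
  show ?thesis
    using False the by (auto simp: at_site_def entries_def less_Suc_eq)
qed

lemma at_site_occupied: "at_site N k p n l i \<Longrightarrow> i \<in> {1..N} \<and> Y l i = k"
proof (induction l arbitrary: i)
  case (Suc l)
  from Suc.prems show ?case unfolding at_site_Suc
  proof (elim disjE exE conjE)
    fix i' assume "at_site N k p n l i'" "next_site N (Y l) (Y (Suc l)) i' = Some i"
    then show ?thesis
      using Suc.IH[of i'] next_site_keeps_type[OF N path_moves, of i' l i] k_nonzero by auto
  qed (use N in \<open>auto simp: arrives_def\<close>)
qed (simp add: at_site_def)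

lemma at_site_unique: "at_site N k p n l i \<Longrightarrow> at_site N k p n' l i \<Longrightarrow> n = n'"
proof (induction l arbitrary: i)
  case (Suc l)
  have clash: False if "at_site N k p m l i'" "next_site N (Y l) (Y (Suc l)) i' = Some i"
    "arrives N k i (Y l) (Y (Suc l))" for m i'
    using arrives_not_next_site[OF N path_moves that(3) k_nonzero, of i'] that at_site_occupied[OF that(1)] k_nonzero
    by auto
  from Suc.prems show ?case unfolding at_site_Suc
  proof (elim disjE exE conjE)
    fix i1 i2
    assume 1: "at_site N k p n l i1" "next_site N (Y l) (Y (Suc l)) i1 = Some i"
      and 2: "at_site N k p n' l i2" "next_site N (Y l) (Y (Suc l)) i2 = Some i"
    then have "i1 = i2"
      using at_site_occupied[OF 1(1)] at_site_occupied[OF 2(1)] k_nonzero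
      by (intro next_site_inj[OF N path_moves, of l i1 i2 i]) auto
    then show ?thesis using Suc.IH 1(1) 2(1) by blast
  qed (use clash in auto)
qed (simp add: at_site_def)

text \<open>Particles present from the start have no entry and are never followed. After an empty
  configuration every occupied site can be traced back to an entry, by \<open>next_site_surj\<close>
  at each transition.\<close>

lemma occupied_at_site:
  assumes "Y l0 = empty_config N" "l0 \<le> l"
  shows "i \<in> {1..N} \<Longrightarrow> Y l i = k \<Longrightarrow> \<exists>n. at_site N k p n l i"
  using assms(2)
proof (induction l arbitrary: i rule: dec_induct)
  case base
  then show ?case using assms(1) k_nonzero by (simp add: empty_config_def)
next
  case (step l)
  have "Y (Suc l) i \<noteq> 0" using step.prems k_nonzero by simp
  from next_site_surj[OF N path_moves step.prems(1) this]
  show ?case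
  proof
    assume "\<exists>i'\<in>{1..N}. Y l i' = Y (Suc l) i \<and> next_site N (Y l) (Y (Suc l)) i' = Some i"
    then obtain i' where i': "i' \<in> {1..N}" "Y l i' = k" "next_site N (Y l) (Y (Suc l)) i' = Some i"
      using step.prems by auto
    then show ?thesis using step.IH[OF i'(1,2)] unfolding at_site_Suc by blast
  next
    assume "arrives N (Y (Suc l) i) i (Y l) (Y (Suc l))"
    then show ?thesis using step.prems unfolding at_site_Suc by auto
  qed
qed

lemma finite_present: "finite {n. present N k p n l}"
  by (rule finite_subset[of _ "{..<l}"]) (auto dest: present_less)

text \<open>Sending a followed particle to its site is injective; unfollowed initial particles only
  add to the occupation. The converse bound needs an earlier empty configuration.\<close>

lemma card_present_le: "card {n. present N k p n l} \<le> occupation N k (Y l)"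
proof -
  define f where "f = (\<lambda>n. SOME i. at_site N k p n l i)"
  have f: "at_site N k p n l (f n)" if "present N k p n l" for n
    using that unfolding present_def f_def by (rule someI_ex)
  show ?thesis
  proof (rule card_inj_on_le)
    show "inj_on f {n. present N k p n l}"
      using f at_site_unique by (intro inj_onI) (metis mem_Collect_eq)
    show "f ` {n. present N k p n l} \<subseteq> {i\<in>{1..N}. Y l i = k}"
      using f at_site_occupied by blast
  qed simp
qed

lemma card_present_ge:
  assumes "Y l0 = empty_config N" "l0 \<le> l"
  shows "occupation N k (Y l) \<le> card {n. present N k p n l}"
proof -
  define g where "g = (\<lambda>i. SOME n. at_site N k p n l i)"
  have g: "at_site N k p (g i) l i" if "i \<in> {i\<in>{1..N}. Y l i = k}" for i
    using occupied_at_site[OF assms, of i] that unfolding g_def by (auto intro: someI_ex)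
  have fun_site: "i = i'" if "at_site N k p n l i" "at_site N k p n l i'" for n i i'
    using that by (simp add: at_site_def)
  show ?thesis
  proof (rule card_inj_on_le)
    show "inj_on g {i\<in>{1..N}. Y l i = k}"
      using g fun_site by (intro inj_onI) metis
    show "g ` {i\<in>{1..N}. Y l i = k} \<subseteq> {n. present N k p n l}"
      using g by (auto simp: present_def)
  qed (rule finite_present)
qed

text \<open>Two indices, because particles that enter before transition \<open>m\<close> may leave
  later: \<open>e\<close> will be an index by which all of them have left.\<close>

definition total_sojourn :: "nat \<Rightarrow> nat \<Rightarrow> real" where
  "total_sojourn m e = (\<Sum>l<e. real (card {n. n < m \<and> present N k p n l}) * H l)"

text \<open>The exchange of sums at the core of Little's formula. The empty configuration at
  \<open>e\<close> guarantees that each sojourn is finite and has ended.\<close>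

lemma sum_sojourn_time:
  assumes "m \<le> e" "Y e = empty_config N"
  shows "(\<Sum>n\<in>entries N k p \<inter> {..<m}. sojourn_time N k p n) = ereal (total_sojourn m e)"
proof -
  have "\<not> present N k p n e" for n
  proof
    assume "present N k p n e"
    then obtain i where "i \<in> {1..N}" "Y e i = k"
      using at_site_occupied unfolding present_def by blast
    then show False using assms(2) k_nonzero by (simp add: empty_config_def)
  qed
  then have "(\<Sum>n\<in>entries N k p \<inter> {..<m}. sojourn_time N k p n) =
      (\<Sum>n\<in>entries N k p \<inter> {..<m}. ereal (\<Sum>l<e. of_bool (present N k p n l) * H l))"
    using assms(1) by (intro sum.cong refl sojourn_time_eq_sum) auto
  also have "\<dots> = ereal (\<Sum>n\<in>entries N k p \<inter> {..<m}. \<Sum>l<e. of_bool (present N k p n l) * H l)"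
    by simp
  also have "(\<Sum>n\<in>entries N k p \<inter> {..<m}. \<Sum>l<e. of_bool (present N k p n l) * H l) =
      (\<Sum>l<e. \<Sum>n\<in>entries N k p \<inter> {..<m}. of_bool (present N k p n l) * H l)"
    by (rule sum.swap)
  also have "\<dots> = total_sojourn m e"
    unfolding total_sojourn_def
  proof (intro sum.cong refl)
    fix l
    have "(\<Sum>n\<in>entries N k p \<inter> {..<m}. of_bool (present N k p n l) * H l) =
        (\<Sum>n\<in>{n. n < m \<and> present N k p n l}. H l)"
      by (rule sum.mono_neutral_cong_right) (auto simp: present_def at_site_def)
    then show "(\<Sum>n\<in>entries N k p \<inter> {..<m}. of_bool (present N k p n l) * H l) =
        real (card {n. n < m \<and> present N k p n l}) * H l" by simp
  qed
  finally show ?thesis .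
qed

lemma total_sojourn_le: "total_sojourn m e \<le> (\<Sum>l<e. real (occupation N k (Y l)) * H l)"
  unfolding total_sojourn_def
proof (intro sum_mono mult_right_mono holding_time_nonneg of_nat_mono)
  fix l
  have "card {n. n < m \<and> present N k p n l} \<le> card {n. present N k p n l}"
    by (intro card_mono finite_present) auto
  then show "card {n. n < m \<and> present N k p n l} \<le> occupation N k (Y l)"
    using card_present_le[of l] by linarith
qed

text \<open>A particle present at some \<open>l < m\<close> entered before \<open>m\<close>, and
  from \<open>l0\<close> on every particle of type \<open>k\<close> is followed. So at most the
  contribution before \<open>l0\<close> is lost, a constant that vanishes on division by
  \<open>m\<close>.\<close>

lemma total_sojourn_ge:
  assumes "Y l0 = empty_config N" "m \<le> e"
  shows "(\<Sum>l<m. real (occupation N k (Y l)) * H l) - (\<Sum>l<l0. real (occupation N k (Y l)) * H l)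
    \<le> total_sojourn m e"
proof -
  let ?f = "\<lambda>l. real (occupation N k (Y l)) * H l"
  have f0: "?f l \<ge> 0" for l by (simp add: holding_time_nonneg)
  \<comment> \<open>The union covers \<open>{..<m}\<close> also when \<open>l0\<close> exceeds
    \<open>m\<close>; the second interval is then empty.\<close>
  have "(\<Sum>l<m. ?f l) \<le> (\<Sum>l\<in>{..<l0} \<union> {l0..<m}. ?f l)"
    using f0 by (intro sum_mono2) auto
  also have "\<dots> = (\<Sum>l<l0. ?f l) + (\<Sum>l\<in>{l0..<m}. ?f l)"
    by (intro sum.union_disjoint) auto
  finally have "(\<Sum>l<m. ?f l) - (\<Sum>l<l0. ?f l) \<le> (\<Sum>l\<in>{l0..<m}. ?f l)"
    by simp
  also have "\<dots> \<le> (\<Sum>l\<in>{l0..<m}. real (card {n. n < m \<and> present N k p n l}) * H l)"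
  proof (intro sum_mono mult_right_mono holding_time_nonneg of_nat_mono)
    fix l assume l: "l \<in> {l0..<m}"
    have "{n. n < m \<and> present N k p n l} = {n. present N k p n l}"
      using l present_less[of N k p _ l] by fastforce
    then show "occupation N k (Y l) \<le> card {n. n < m \<and> present N k p n l}"
      using card_present_ge[OF assms(1), of l] l by simp
  qed
  also have "\<dots> \<le> total_sojourn m e"
    unfolding total_sojourn_def using assms(2)
    by (intro sum_mono2) (auto simp: holding_time_nonneg)
  finally show ?thesis .
qed

end

section \<open>Little's formula along a path\<close>

lemma infinite_if_frequency_pos:
  assumes "(\<lambda>m. (\<Sum>i<m. of_bool (P i)) / real m) \<longlonglongrightarrow> v" "v > 0"
  shows "infinite {i. P i}"
proof
  assume fin: "finite {i. P i}"
  have le: "(\<Sum>i<m. of_bool (P i) :: real) \<le> real (card {i. P i})" for m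
    using fin by (simp add: card_mono)
  have "(\<lambda>m. (\<Sum>i<m. of_bool (P i)) / real m) \<longlonglongrightarrow> 0"
  proof (rule Lim_null_comparison)
    show "\<forall>\<^sub>F m in sequentially. norm ((\<Sum>i<m. of_bool (P i)) / real m) \<le> real (card {i. P i}) / real m"
      using le by (intro always_eventually allI) (auto simp: divide_right_mono)
  qed (rule lim_const_over_n)
  with assms show False using LIMSEQ_unique by fastforce
qed

text \<open>No occurrence lies between \<open>m\<close> and \<open>e m\<close>, so the counts at
  both indices agree. Both relative frequencies tend to \<open>v\<close>, and their quotient is
  \<open>e m / m\<close>.\<close>

lemma next_occurrence_asymp:
  assumes lim: "(\<lambda>m. (\<Sum>i<m. of_bool (P i)) / real m) \<longlonglongrightarrow> v" and v: "v > 0"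
  defines "e \<equiv> \<lambda>m. LEAST n. m \<le> n \<and> P n"
  shows "m \<le> e m" "P (e m)" "filterlim e at_top at_top" "(\<lambda>m. real (e m) / real m) \<longlonglongrightarrow> 1"
proof -
  have "\<exists>n. m \<le> n \<and> P n" for m
    using infinite_if_frequency_pos[OF lim v] by (auto simp: infinite_nat_iff_unbounded_le)
  then have e: "m \<le> e m \<and> P (e m)" for m
    unfolding e_def by (rule LeastI_ex)
  then show "m \<le> e m" "P (e m)" by auto
  show e_top: "filterlim e at_top at_top"
    using e by (intro filterlim_at_top_mono[OF filterlim_ident]) auto
  define C where "C = (\<lambda>m. \<Sum>i<m. of_bool (P i) :: real)"
  have C_e: "C (e m) = C m" for m
  proof -
    have "\<not> P i" if "m \<le> i" "i < e m" for i
      using not_less_Least[of i "\<lambda>n. m \<le> n \<and> P n"] that unfolding e_def by blast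
    then show ?thesis
      unfolding C_def using e[of m] by (intro sum.mono_neutral_right) auto
  qed
  have lim': "(\<lambda>m. C m / real m) \<longlonglongrightarrow> v" using lim by (simp only: C_def)
  have "(\<lambda>m. (C m / real m) / (C (e m) / real (e m))) \<longlonglongrightarrow> v / v"
    using v by (intro tendsto_divide lim' filterlim_compose[OF lim' e_top]) auto
  moreover have "\<forall>\<^sub>F m in sequentially. (C m / real m) / (C (e m) / real (e m)) = real (e m) / real m"
    using order_tendstoD(1)[OF lim' v] by eventually_elim (auto simp: C_e)
  ultimately show "(\<lambda>m. real (e m) / real m) \<longlonglongrightarrow> 1"
    using v tendsto_cong by force
qed

lemma initial_segment_enumerate:
  fixes S :: "nat set"
  assumes "infinite S"
  shows "S \<inter> {..<enumerate S n} = enumerate S ` {..<n}"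
proof (intro equalityI subsetI)
  fix s assume s: "s \<in> S \<inter> {..<enumerate S n}"
  then obtain j where "enumerate S j = s" using enumerate_Ex[OF assms] by auto
  then show "s \<in> enumerate S ` {..<n}" using s assms by auto
qed (use assms enumerate_in_set in auto)

context exclusion_path begin

text \<open>\<open>s\<close> is occupation time per transition and \<open>a\<close> is entries per
  transition, so \<open>s / a\<close> is time per entry.\<close>

lemma mean_sojourn_time_limit:
  assumes empties: "(\<lambda>m. (\<Sum>l<m. of_bool (Y l = empty_config N)) / real m) \<longlonglongrightarrow> v" and v: "v > 0"
    and occ: "(\<lambda>m. (\<Sum>l<m. real (occupation N k (Y l)) * H l) / real m) \<longlonglongrightarrow> s"
    and ent: "(\<lambda>m. (\<Sum>l<m. of_bool (l \<in> entries N k p)) / real m) \<longlonglongrightarrow> a" and a: "a > 0"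
  shows "infinite (entries N k p)" "mean_sojourn_time N k p \<longlonglongrightarrow> ereal (s / a)"
proof -
  show inf: "infinite (entries N k p)"
    using infinite_if_frequency_pos[OF ent a] by simp
  define e where "e m = (LEAST n. m \<le> n \<and> Y n = empty_config N)" for m
  note e = next_occurrence_asymp[OF empties v, folded e_def]
  define S where "S = (\<lambda>m. \<Sum>l<m. real (occupation N k (Y l)) * H l)"
  have S: "(\<lambda>m. S m / real m) \<longlonglongrightarrow> s" using occ by (simp only: S_def)
  \<comment> \<open>The lower bound starts from the first empty configuration, at index
    \<open>e 0\<close>. The upper bound runs up to \<open>e m\<close>, and rescaling it to
    \<open>m\<close> costs the factor \<open>e m / m\<close>, which tends to 1.\<close>
  have total: "(\<lambda>m. total_sojourn m (e m) / real m) \<longlonglongrightarrow> s"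
  proof (rule tendsto_sandwich)
    have "S m - S (e 0) \<le> total_sojourn m (e m)" for m
      unfolding S_def by (rule total_sojourn_ge[OF e(2) e(1)])
    then show "\<forall>\<^sub>F m in sequentially. S m / real m - S (e 0) / real m \<le> total_sojourn m (e m) / real m"
      by (intro always_eventually allI) (simp add: divide_right_mono flip: diff_divide_distrib)
    show "(\<lambda>m. S m / real m - S (e 0) / real m) \<longlonglongrightarrow> s"
      using tendsto_diff[OF S lim_const_over_n[of "S (e 0)"]] by simp
    have "total_sojourn m (e m) / real m \<le> (S (e m) / real (e m)) * (real (e m) / real m)"
      if "m \<ge> 1" for m
    proof -
      have "total_sojourn m (e m) / real m \<le> S (e m) / real m"
        unfolding S_def by (intro divide_right_mono total_sojourn_le) auto
      then show ?thesis using e(1)[of m] that by simp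
    qed
    then show "\<forall>\<^sub>F m in sequentially. total_sojourn m (e m) / real m \<le> (S (e m) / real (e m)) * (real (e m) / real m)"
      by (rule eventually_sequentiallyI)
    show "(\<lambda>m. (S (e m) / real (e m)) * (real (e m) / real m)) \<longlonglongrightarrow> s"
      using tendsto_mult[OF filterlim_compose[OF S e(3)] e(4)] by simp
  qed
  define E where "E = enumerate (entries N k p)"
  have E_top: "filterlim E at_top at_top"
    unfolding E_def using le_enumerate[OF inf]
    by (intro filterlim_at_top_mono[OF filterlim_ident]) auto
  have inj: "inj_on E {..<n}" for n
    unfolding E_def using inj_enumerate[OF inf] by (rule inj_on_subset) simp
  have seg: "entries N k p \<inter> {..<E n} = E ` {..<n}" for n
    unfolding E_def by (rule initial_segment_enumerate[OF inf])
  \<comment> \<open>Enumeration starts at 0, so exactly \<open>n\<close> entries precede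
    \<open>E n\<close>, which is not among them. Cutting off at \<open>E n\<close> thus selects the
    first \<open>n\<close> particles.\<close>
  have count: "(\<Sum>l<E n. of_bool (l \<in> entries N k p)) = real n" for n
  proof -
    have "(\<Sum>l<E n. of_bool (l \<in> entries N k p)) = real (card (entries N k p \<inter> {..<E n}))"
      by (simp add: Int_def conj_commute)
    then show ?thesis unfolding seg using inj by (simp add: card_image)
  qed
  have sum: "(\<Sum>j<n. sojourn_time N k p (E j)) = ereal (total_sojourn (E n) (e (E n)))" for n
  proof -
    have "(\<Sum>j<n. sojourn_time N k p (E j)) = (\<Sum>n'\<in>E ` {..<n}. sojourn_time N k p n')"
      using inj by (simp add: sum.reindex)
    then show ?thesis
      using sum_sojourn_time[OF e(1) e(2), of "E n"] unfolding seg by simp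
  qed
  have "(\<lambda>n. (total_sojourn (E n) (e (E n)) / real (E n)) / ((\<Sum>l<E n. of_bool (l \<in> entries N k p)) / real (E n))) \<longlonglongrightarrow> s / a"
    using a by (intro tendsto_divide filterlim_compose[OF total E_top] filterlim_compose[OF ent E_top]) auto
  then have lim: "(\<lambda>n. ereal ((total_sojourn (E n) (e (E n)) / real (E n)) / (real n / real (E n)))) \<longlonglongrightarrow> ereal (s / a)"
    unfolding count by simp
  have "mean_sojourn_time N k p n = ereal ((total_sojourn (E n) (e (E n)) / real (E n)) / (real n / real (E n)))"
    if "n \<ge> 1" for n
  proof -
    have "E n \<noteq> 0" using le_enumerate[OF inf, of n] that unfolding E_def by simp
    then show ?thesis
      using that sum[of n] unfolding mean_sojourn_time_def E_def by simp
  qed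
  then have ev: "\<forall>\<^sub>F n in sequentially. mean_sojourn_time N k p n =
      ereal ((total_sojourn (E n) (e (E n)) / real (E n)) / (real n / real (E n)))"
    by (rule eventually_sequentiallyI)
  show "mean_sojourn_time N k p \<longlonglongrightarrow> ereal (s / a)"
    using tendsto_cong[OF ev] lim by blast
qed

end

theorem theorem6:
  fixes M :: "'w measure" and x :: "real \<Rightarrow> 'w \<Rightarrow> config"
    and N K :: nat and \<alpha> \<beta> \<delta> :: "nat \<Rightarrow> real"
  assumes "N \<ge> 2" and "K \<ge> 1"
    and "\<And>k. k \<in> {1..K} \<Longrightarrow> \<alpha> k > 0"
    and "\<And>k. k \<in> {1..K} \<Longrightarrow> \<beta> k > 0"
    and "\<And>k. k \<in> {1..K} \<Longrightarrow> \<delta> k > 0"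
    and "finite_ctmc M (configs N K) (exclusion_rate N K \<alpha> \<beta> \<delta>) x"
  shows "\<forall>k \<in> {1..K}. has_average_sojourn_time M N x k (real N / (2 * \<beta> k))"
proof
  fix k assume k: "k \<in> {1..K}"
  interpret X: exclusion N K \<alpha> \<beta> \<delta>
    using assms by unfold_locales
  interpret C: reversible_ctmc M "configs N K" "exclusion_rate N K \<alpha> \<beta> \<delta>" x X.weight
  proof (intro reversible_ctmc.intro nonabsorbing_ctmc.intro assms(6))
    show "nonabsorbing_ctmc_axioms (configs N K) (exclusion_rate N K \<alpha> \<beta> \<delta>)"
      using X.rate_nonneg X.exit_rate_pos by unfold_locales
    show "reversible_ctmc_axioms (configs N K) (exclusion_rate N K \<alpha> \<beta> \<delta>) X.weight"
      using X.rate_self X.weight_pos X.rate_balance X.rates_irreducible by unfold_locales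
  qed
  let ?occ = "\<lambda>c. real (occupation N k c)"
  let ?arr = "\<lambda>c d. of_bool (\<exists>i. arrives N k i c d) :: real"
  let ?z = "X.Z ^ (N - 1)"
  note pos = C.\<kappa>_pos X.Z_pos X.\<alpha>_pos[OF k] X.\<beta>_pos[OF k]
  have "AE \<omega> in M. infinite (entries N k (\<lambda>t. x t \<omega>)) \<and>
      mean_sojourn_time N k (\<lambda>t. x t \<omega>) \<longlonglongrightarrow> ereal (real N / (2 * \<beta> k))"
    using C.AE_visit_frequency C.ergodic_occupation[of ?occ] C.ergodic_transitions[of ?arr]
      C.AE_jump_prob_nonzero AE_space
  proof eventually_elim
    case (elim \<omega>)
    let ?p = "\<lambda>t. x t \<omega>"
    interpret P: exclusion_path N K \<alpha> \<beta> \<delta> ?p k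
    proof
      fix n
      show Y: "jump_state ?p n \<in> configs N K" for n by (rule C.Y_in[OF elim(5)])
      \<comment> \<open>A transition with nonzero jump probability has a nonzero rate, so almost
        surely every step of the path is a genuine move.\<close>
      have "exclusion_rate N K \<alpha> \<beta> \<delta> (jump_state ?p n) (jump_state ?p (Suc n)) \<noteq> 0"
        using elim(4) C.rate_eq_jump_prob[OF Y Y, of n "Suc n"] X.exit_rate_pos[OF Y[of n]] by auto
      then show "moves N K (jump_state ?p n) (jump_state ?p (Suc n))"
        by (rule X.moves_if_rate_nonzero)
    qed (rule k)
    have v: "C.\<kappa> * X.weight (empty_config N) * C.q (empty_config N) > 0"
      using pos X.weight_pos[OF empty_config_in] X.exit_rate_pos[OF empty_config_in] by simp
    have empties: "(\<lambda>m. (\<Sum>i<m. of_bool (jump_state ?p i = empty_config N)) / real m)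
        \<longlonglongrightarrow> C.\<kappa> * X.weight (empty_config N) * C.q (empty_config N)"
      using elim(1) empty_config_in by blast
    have occ: "(\<lambda>m. (\<Sum>i<m. ?occ (jump_state ?p i) * holding_time ?p i) / real m)
        \<longlonglongrightarrow> C.\<kappa> * (real N * (X.\<rho> k * ?z))"
      using elim(2) unfolding X.mean_occupation[OF k] .
    have ent: "(\<lambda>m. (\<Sum>i<m. of_bool (i \<in> entries N k ?p)) / real m) \<longlonglongrightarrow> C.\<kappa> * (2 * \<alpha> k * ?z)"
      using elim(3) unfolding X.mean_entry_rate[OF k] entries_def mem_Collect_eq .
    have a: "C.\<kappa> * (2 * \<alpha> k * ?z) > 0"
      using pos by simp
    \<comment> \<open>\<open>\<kappa>\<close> and the power of \<open>Z\<close> cancel, and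
      \<open>\<rho> k / \<alpha> k = 1 / \<beta> k\<close>.\<close>
    have "C.\<kappa> * (real N * (X.\<rho> k * ?z)) / (C.\<kappa> * (2 * \<alpha> k * ?z)) = real N / (2 * \<beta> k)"
      using pos k by (simp add: X.\<rho>_def)
    then show ?case
      using P.mean_sojourn_time_limit[OF empties v occ ent a] by simp
  qed
  then show "has_average_sojourn_time M N x k (real N / (2 * \<beta> k))"
    by (simp add: has_average_sojourn_time_def)
qed

end
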